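(* Let $A\in\mathcal{M}(\lambda,\Lambda)$ for some $\lambda,\Lambda>0$ and suppose that $A$ satisfies the Cordes condition with some constant $\delta\in(0,1]$. Let $r\in L^2_{\mathrm{per}}(Y)$ denote the invariant measure to $A$ and let $(r_h)_{h>0}\subset L^2_{\mathrm{per}}(Y)$ be such that $\|r-r_h\|_{L^2(Y)}\to0$ as $h\searrow0$. Let $\bar A:=\int_YrA\in\mathbb{R}^{n\times n}_{\mathrm{sym}}$ and $\bar A_h:=\int_Yr_hA\in\mathbb{R}^{n\times n}_{\mathrm{sym}}$. Then $$|\bar A-\bar A_h|\le\sqrt{n}\,\Lambda\|r-r_h\|_{L^1(Y)}\le\sqrt{n}\,\Lambda\|r-r_h\|_{L^2(Y)},$$ and $\bar A_h$ is positive definite for $h>0$ sufficiently small.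
   Context: $Y:=(0,1)^n$; "$Y$-periodic" means $\mathbb{Z}^n$-periodic. For $\lambda,\Lambda>0$, $\mathcal{M}(\lambda,\Lambda)$ denotes the set of all $Y$-periodic $A\in L^\infty(\mathbb{R}^n;\mathbb{R}^{n\times n}_{\mathrm{sym}})$ such that $\lambda|\xi|^2\le A\xi\cdot\xi\le\Lambda|\xi|^2$ a.e. in $\mathbb{R}^n$ for all $\xi\in\mathbb{R}^n\setminus\{0\}$. For matrices, $P:Q:=\sum_{i,j}p_{ij}q_{ij}$ and $|P|:=\sqrt{P:P}$. $A$ satisfies the Cordes condition with constant $\delta\in(0,1]$ if $\frac{|A|^2}{(\mathrm{tr}(A))^2}\le\frac{1}{n-1+\delta}$ a.e. in $\mathbb{R}^n$. $L^2_{\mathrm{per}}(Y)$, $H^k_{\mathrm{per}}(Y)$ are the usual spaces of $Y$-periodic functions. An invariant measure to $A$ is a function $r\in L^2_{\mathrm{per}}(Y)$ with $\int_Yr=1$ and $(r,-A:D^2\varphi)_{L^2(Y)}=0$ for all $\varphi\in H^2_{\mathrm{per}}(Y)$; under the Cordes condition it exists and is unique. *)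

theory Defs
  imports "HOL-Analysis.Analysis"
begin

text \<open>Functions stand for their almost-everywhere classes throughout: they are Lebesgue
  measurable representatives defined on all of \<open>real ^ 'n\<close>, with \<open>n = CARD('n)\<close>. For matrices,
  \<open>P : Q\<close> is the library inner product and \<open>|P|\<close> the library norm on \<open>real ^ 'n ^ 'n\<close>.\<close>

lemma matrix_inner_eq: "P \<bullet> Q = (\<Sum>i\<in>UNIV. \<Sum>j\<in>UNIV. P $ i $ j * Q $ i $ j)"
  for P Q :: "real ^ 'n ^ 'n"
  by (simp add: inner_vec_def)

lemma matrix_norm_eq: "norm P = sqrt (P \<bullet> P)" for P :: "real ^ 'n ^ 'n"
  by (rule norm_eq_sqrt_inner)

definition unit_cell :: "(real ^ 'n) set" where
  "unit_cell = box 0 1"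

lemma unit_cell_eq: "unit_cell = {x :: real ^ 'n. \<forall>i. 0 < x $ i \<and> x $ i < 1}"
  by (auto simp: unit_cell_def mem_box_cart)

definition cell_periodic :: "(real ^ 'n \<Rightarrow> 'b) \<Rightarrow> bool" where
  "cell_periodic f \<longleftrightarrow>
     (\<forall>k. (\<forall>i. k $ i \<in> \<int>) \<longrightarrow> (AE x in lebesgue. f (x + k) = f x))"

definition L2_per :: "(real ^ 'n \<Rightarrow> real) set" where
  "L2_per = {f. f \<in> borel_measurable lebesgue \<and> cell_periodic f \<and>
                integrable (lebesgue_on unit_cell) (\<lambda>x. (f x)\<^sup>2)}"

definition L1_norm :: "(real ^ 'n \<Rightarrow> real) \<Rightarrow> real" where
  "L1_norm f = (LINT x|lebesgue_on unit_cell. \<bar>f x\<bar>)"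

definition L2_norm :: "(real ^ 'n \<Rightarrow> real) \<Rightarrow> real" where
  "L2_norm f = sqrt (LINT x|lebesgue_on unit_cell. (f x)\<^sup>2)"

definition partial_deriv :: "'n \<Rightarrow> (real ^ 'n \<Rightarrow> real) \<Rightarrow> real ^ 'n \<Rightarrow> real" where
  "partial_deriv i f x = frechet_derivative f (at x) (axis i 1)"

text \<open>A multi-index is given as the list of the coordinate directions to differentiate in.\<close>

definition iter_partial :: "'n list \<Rightarrow> (real ^ 'n \<Rightarrow> real) \<Rightarrow> real ^ 'n \<Rightarrow> real" where
  "iter_partial is f = foldr partial_deriv is f"

definition test_function :: "(real ^ 'n \<Rightarrow> real) \<Rightarrow> bool" where
  "test_function \<psi> \<longleftrightarrow>
     (\<forall>is. iter_partial is \<psi> differentiable_on UNIV) \<and> compact (closure {x. \<psi> x \<noteq> 0})"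

definition locally_integrable :: "(real ^ 'n \<Rightarrow> real) \<Rightarrow> bool" where
  "locally_integrable f \<longleftrightarrow> (\<forall>K. compact K \<longrightarrow> set_integrable lebesgue K f)"

definition has_weak_deriv ::
    "'n list \<Rightarrow> (real ^ 'n \<Rightarrow> real) \<Rightarrow> (real ^ 'n \<Rightarrow> real) \<Rightarrow> bool" where
  "has_weak_deriv is u v \<longleftrightarrow> locally_integrable u \<and> locally_integrable v \<and>
     (\<forall>\<psi>. test_function \<psi> \<longrightarrow>
        (LINT x|lebesgue. u x * iter_partial is \<psi> x)
          = (- 1) ^ length is * (LINT x|lebesgue. v x * \<psi> x))"

definition H_per :: "nat \<Rightarrow> (real ^ 'n \<Rightarrow> real) set" where
  "H_per k = {u \<in> L2_per. \<forall>is. length is \<le> k \<longrightarrow> (\<exists>v\<in>L2_per. has_weak_deriv is u v)}"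

definition has_weak_hessian ::
    "(real ^ 'n \<Rightarrow> real) \<Rightarrow> (real ^ 'n \<Rightarrow> real ^ 'n ^ 'n) \<Rightarrow> bool" where
  "has_weak_hessian u D \<longleftrightarrow> (\<forall>i j. has_weak_deriv [i, j] u (\<lambda>x. D x $ i $ j))"

definition elliptic_class :: "real \<Rightarrow> real \<Rightarrow> (real ^ 'n \<Rightarrow> real ^ 'n ^ 'n) set" where
  "elliptic_class lam Lam =
     {A. A \<in> borel_measurable lebesgue \<and>
         (\<exists>C. AE x in lebesgue. norm (A x) \<le> C) \<and>
         cell_periodic A \<and>
         (AE x in lebesgue. transpose (A x) = A x) \<and>
         (\<forall>\<xi>. \<xi> \<noteq> 0 \<longrightarrow>
            (AE x in lebesgue. lam * (norm \<xi>)\<^sup>2 \<le> (A x *v \<xi>) \<bullet> \<xi> \<and>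
                               (A x *v \<xi>) \<bullet> \<xi> \<le> Lam * (norm \<xi>)\<^sup>2))}"

text \<open>For a uniformly elliptic \<open>A\<close> the trace is positive almost everywhere, so the convention
  \<open>x / 0 = 0\<close> plays no role here.\<close>

definition cordes :: "real \<Rightarrow> (real ^ 'n \<Rightarrow> real ^ 'n ^ 'n) \<Rightarrow> bool" where
  "cordes \<delta> A \<longleftrightarrow>
     (AE x in lebesgue. (norm (A x))\<^sup>2 / (trace (A x))\<^sup>2 \<le> 1 / (real CARD('n) - 1 + \<delta>))"

text \<open>The weak Hessian \<open>D\<close> of \<open>\<phi>\<close> is unique up to null sets, so quantifying over all of its
  representatives does not change the condition.\<close>

definition invariant_measure ::
    "(real ^ 'n \<Rightarrow> real ^ 'n ^ 'n) \<Rightarrow> (real ^ 'n \<Rightarrow> real) \<Rightarrow> bool" where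
  "invariant_measure A r \<longleftrightarrow>
     r \<in> L2_per \<and> (LINT x|lebesgue_on unit_cell. r x) = 1 \<and>
     (\<forall>\<phi>\<in>H_per 2. \<forall>D. has_weak_hessian \<phi> D \<longrightarrow>
        (LINT x|lebesgue_on unit_cell. r x * (- (A x \<bullet> D x))) = 0)"

definition weighted_mean ::
    "(real ^ 'n \<Rightarrow> real) \<Rightarrow> (real ^ 'n \<Rightarrow> real ^ 'n ^ 'n) \<Rightarrow> real ^ 'n ^ 'n" where
  "weighted_mean r A = (LINT x|lebesgue_on unit_cell. r x *\<^sub>R A x)"

definition positive_definite :: "real ^ 'n ^ 'n \<Rightarrow> bool" where
  "positive_definite M \<longleftrightarrow> transpose M = M \<and> (\<forall>\<xi>. \<xi> \<noteq> 0 \<longrightarrow> 0 < (M *v \<xi>) \<bullet> \<xi>)"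

end

theory Submission
  imports Defs
begin

text \<open>The estimate for \<open>\<bar>A - A\<^sub>h\<bar>\<close> of the means is the triangle inequality for integrals together with
  \<open>\<bar>A x\<bar> \<le> sqrt n * Lam\<close>, which holds because the columns \<open>A x e\<^sub>j\<close> of a symmetric matrix with
  spectrum in \<open>[0, Lam]\<close> have length at most \<open>Lam\<close>. Since the means converge, positive
  definiteness of \<open>A\<^sub>h\<close> for small \<open>h\<close> follows once the mean of \<open>r A\<close> itself is positive definite
  (\<open>weighted_mean_invariant_measure_coercive\<close>), and this is where the work lies: one has to
  extract some positivity of \<open>r\<close> from its weak equation, although the coefficients are only measurable.

  Put \<open>\<gamma> = tr A / \<bar>A\<bar>\<^sup>2\<close>, \<open>B = \<gamma> A\<close> and \<open>\<rho> = r / \<gamma>\<close>. The Cordes condition says exactly that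
  \<open>\<bar>B - I\<bar> \<le> sqrt (1 - \<delta>) < 1\<close>, and the invariant measure equation says that \<open>\<rho>\<close> is orthogonal to
  \<open>B : D\<^sup>2\<phi>\<close> for all periodic \<open>\<phi>\<close>. The claim to prove is that, for bounded \<open>g \<ge> m\<close>,
  \<open>\<integral> \<rho> g \<ge> m \<integral> \<rho>\<close> if \<open>\<integral> \<rho> \<ge> 0\<close> and \<open>\<integral> \<rho> g \<le> m \<integral> \<rho>\<close> if \<open>\<integral> \<rho> \<le> 0\<close>
  (\<open>weighted_integral_bounds\<close>).
  Taking \<open>g = \<gamma>\<close>, for which \<open>\<integral> \<rho> \<gamma> = \<integral> r = 1\<close>, gives \<open>\<integral> \<rho> > 0\<close>; taking
  \<open>g = B \<xi> \<cdot> \<xi> \<ge> (1 - sqrt (1 - \<delta>)) \<bar>\<xi>\<bar>\<^sup>2\<close> then gives coercivity of the mean of \<open>r A = \<rho> B\<close>.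

  For the claim, suppose first that \<open>B\<close> and \<open>g\<close> are trigonometric polynomials. One wants \<open>\<phi>\<close> and a
  constant \<open>c\<close> with \<open>B : D\<^sup>2\<phi> = g - c\<close>. Writing \<open>u = \<Delta>\<phi>\<close>, the equation is \<open>u + T u = g - c\<close> with
  \<open>T u = (B - I) : D\<^sup>2 \<Delta>\<^sup>-\<^sup>1 u\<close>, and \<open>T\<close> is a strict contraction of \<open>L\<^sup>2\<close> because
  \<open>D\<^sup>2 \<Delta>\<^sup>-\<^sup>1\<close> is an isometry by Parseval (\<open>cordes_contraction\<close>). The terms of the Neumann series
  are again trigonometric polynomials. Their degrees grow linearly, so their supremum norms exceed their
  \<open>L\<^sup>2\<close> norms at most by a polynomial factor, and the remainder tends to zero uniformly
  (\<open>approximate_solution\<close>). Thus partial sums solve the equation up to a uniformly small error, with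
  smooth \<open>\<phi>\<close>, so that at a maximum of \<open>\<phi>\<close> the classical maximum principle yields
  \<open>c \<ge> min g\<close> up to that error.

  For general data, \<open>(B, g)\<close> is approximated almost everywhere by trigonometric polynomials whose values
  stay near a convex set on which \<open>\<bar>B - I\<bar> \<le> sqrt (1 - \<delta>)\<close> and \<open>g \<ge> m\<close>
  (\<open>trig_poly_approximation\<close>). As the Hessians remain bounded in
  \<open>L\<^sup>2\<close>, orthogonality of \<open>\<rho>\<close> passes to the limit and \<open>\<integral> \<rho> g = lim c\<^sub>k \<integral> \<rho>\<close> with
  \<open>liminf c\<^sub>k \<ge> m\<close> (\<open>weighted_integral_limit\<close>).\<close>

section \<open>Trigonometric polynomials on the unit cell\<close>

text \<open>Frequencies are integer points of \<open>real ^ 'n\<close> rather than elements of \<open>int ^ 'n\<close>, so that inner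
  products with points need no coercions; sums run over cubes, which add up nicely under products.\<close>

definition freqs :: "nat \<Rightarrow> (real ^ 'n) set" where
  "freqs M = {k. \<forall>i. k $ i \<in> \<int> \<and> \<bar>k $ i\<bar> \<le> real M}"

definition character :: "real ^ 'n \<Rightarrow> real ^ 'n \<Rightarrow> complex" where
  "character k x = cis (2 * pi * (k \<bullet> x))"

definition trig_sum :: "nat \<Rightarrow> (real ^ 'n \<Rightarrow> complex) \<Rightarrow> real ^ 'n \<Rightarrow> complex" where
  "trig_sum M c x = (\<Sum>k\<in>freqs M. c k * character k x)"

lemma integral_cis_period:
  fixes m :: real
  assumes "m \<in> \<int>"
  shows "(LINT t|lborel. indicator {0<..<1} t *\<^sub>R cis (2 * pi * m * t)) = (if m = 0 then 1 else 0)"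
proof (cases "m = 0")
  case True
  then show ?thesis by simp
next
  case False
  define c where "c = complex_of_real (2 * pi * m) * \<i>"
  have c: "c \<noteq> 0" using False by (simp add: c_def)
  have cis: "cis (2 * pi * m * t) = exp (t *\<^sub>R c)" for t
    by (simp add: c_def cis_conv_exp scaleR_conv_of_real algebra_simps)
  define F where "F t = exp (t *\<^sub>R c) * inverse c" for t
  have "((LBINT t=0..1. cis (2 * pi * m * t))) = F 1 - F 0"
    unfolding zero_ereal_def one_ereal_def
  proof (rule interval_integral_FTC_finite)
    show "continuous_on {min 0 1..max 0 1} (\<lambda>t. cis (2 * pi * m * t))"
      by (intro continuous_intros)
    show "(F has_vector_derivative cis (2 * pi * m * t)) (at t within {min 0 1..max 0 1})" for t
      unfolding F_def cis
      by (rule has_vector_derivative_eq_rhs[OF has_vector_derivative_mult_left[OF exp_scaleR_has_vector_derivative_right]])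
         (use c in simp)
  qed
  also have "\<dots> = 0"
  proof -
    obtain z :: int where "m = z" using assms by (auto elim: Ints_cases)
    then have "cis (2 * pi * m) = 1"
      by (metis cis_multiple_2pi assms)
    then show ?thesis using cis[of 1] by (simp add: F_def)
  qed
  finally show ?thesis using False
    by (simp add: interval_lebesgue_integral_def set_lebesgue_integral_def einterval_def greaterThanLessThan_def greaterThan_def lessThan_def Collect_conj_eq)
qed

lemma continuous_on_character [continuous_intros]:
  "continuous_on S f \<Longrightarrow> continuous_on S (\<lambda>x. character k (f x))"
  unfolding character_def by (intro continuous_intros)

lemma unit_cell_borel [measurable]: "unit_cell \<in> sets borel"
  by (simp add: unit_cell_def)

text \<open>Over the cell both the indicator and the character are products over the coordinates, which
  reduces orthogonality to the one-dimensional integrals over a period.\<close>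

lemma integral_character:
  fixes k :: "real ^ 'n"
  assumes "\<And>i. k $ i \<in> \<int>"
  shows "(LINT x|lebesgue_on unit_cell. character k x) = (if k = 0 then 1 else 0)"
proof -
  interpret product_sigma_finite "\<lambda>_::real^'n. lborel :: real measure"
    by standard
  let ?s = "\<lambda>f. \<Sum>b\<in>Basis. f b *\<^sub>R (b :: real^'n)"
  have bm: "character k \<in> borel_measurable borel"
    by (intro borel_measurable_continuous_onI continuous_intros)
  have box: "indicator unit_cell (?s f) = (\<Prod>b\<in>Basis. indicator {0<..<1} (f b) :: real)" for f
  proof -
    have "?s f \<in> unit_cell \<longleftrightarrow> (\<forall>b\<in>Basis. f b \<in> {0<..<1})"
      unfolding unit_cell_def mem_box
      by (auto simp: inner_sum_left_Basis) (auto simp: Basis_vec_def inner_axis)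
    then show ?thesis
      by (auto simp: indicator_def intro!: prod.neutral[symmetric])
  qed
  have ch: "character k (?s f) = (\<Prod>b\<in>Basis. cis (2 * pi * (k \<bullet> b) * f b))" for f
    unfolding character_def cis_conv_exp
    by (subst exp_sum[symmetric])
       (auto simp: inner_sum_right sum_distrib_left sum_distrib_right algebra_simps)
  have "(LINT x|lebesgue_on unit_cell. character k x) =
        (LINT x|lborel. indicator unit_cell x *\<^sub>R character k x)"
    by (subst integral_restrict_space) (auto intro!: integral_completion borel_measurable_scaleR simp: bm)
  also have "\<dots> = (LINT f|(\<Pi>\<^sub>M b\<in>Basis. lborel). indicator unit_cell (?s f) *\<^sub>R character k (?s f))"
    by (subst lborel_eq, subst integral_distr) (auto intro!: borel_measurable_scaleR simp: bm)
  also have "\<dots> = (LINT f|(\<Pi>\<^sub>M b\<in>Basis. lborel).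
      (\<Prod>b\<in>Basis. indicator {0<..<1} (f b) *\<^sub>R cis (2 * pi * (k \<bullet> b) * f b)))"
    unfolding box ch by (simp add: scaleR_conv_of_real prod.distrib)
  also have "\<dots> = (\<Prod>b\<in>Basis. LINT t|lborel. indicator {0<..<1} t *\<^sub>R cis (2 * pi * (k \<bullet> b) * t))"
  proof (rule product_integral_prod)
    show "integrable lborel (\<lambda>t. indicator {0<..<1} t *\<^sub>R cis (2 * pi * (k \<bullet> b) * t))" for b
      by (rule integrableI_bounded_set[where A="{0<..<1}" and B=1], simp, rule borel_measurable_scaleR)
         (auto simp: indicator_def split: if_splits intro!: borel_measurable_continuous_onI continuous_intros)
  qed simp
  also have "\<dots> = (\<Prod>b\<in>Basis. if k \<bullet> b = 0 then 1 else 0)"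
    by (intro prod.cong refl, subst integral_cis_period)
       (use assms in \<open>auto simp: Basis_vec_def cart_eq_inner_axis\<close>)
  also have "\<dots> = (if k = 0 then 1 else 0)"
    by (auto simp: euclidean_eq_iff[of k])
  finally show ?thesis .
qed

lemma freqs_eq_image: "freqs M = (\<lambda>g. \<chi> i. of_int (g i)) ` (UNIV \<rightarrow>\<^sub>E {- int M..int M})"
proof (intro equalityI subsetI)
  fix k :: "real ^ 'n" assume k: "k \<in> freqs M"
  show "k \<in> (\<lambda>g. \<chi> i. of_int (g i)) ` (UNIV \<rightarrow>\<^sub>E {- int M..int M})"
  proof (rule image_eqI)
    show "k = (\<chi> i. of_int \<lfloor>k $ i\<rfloor>)"
      using k by (simp add: freqs_def vec_eq_iff)
    show "(\<lambda>i. \<lfloor>k $ i\<rfloor>) \<in> UNIV \<rightarrow>\<^sub>E {- int M..int M}"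
    proof -
      have "\<lfloor>k $ i\<rfloor> \<in> {- int M..int M}" for i
        using k by (auto simp: freqs_def abs_le_iff le_floor_iff floor_le_iff minus_le_iff
            intro: le_less_trans[of "k $ i" "real M"])
      then show ?thesis by (simp add: PiE_UNIV_domain)
    qed
  qed
next
  fix k :: "real ^ 'n" assume "k \<in> (\<lambda>g. \<chi> i. of_int (g i)) ` (UNIV \<rightarrow>\<^sub>E {- int M..int M})"
  then obtain g :: "'n \<Rightarrow> int" where g: "k = (\<chi> i. of_int (g i))" "g \<in> UNIV \<rightarrow>\<^sub>E {- int M..int M}"
    by blast
  have "\<bar>real_of_int (g i)\<bar> \<le> real M" for i
    using PiE_mem[OF g(2), of i] by auto
  then show "k \<in> freqs M"
    by (simp add: freqs_def g(1))
qed

lemma finite_freqs [simp]: "finite (freqs M)"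
  by (simp add: freqs_eq_image finite_PiE)

lemma card_freqs_le: "card (freqs M :: (real ^ 'n) set) \<le> (2 * M + 1) ^ CARD('n)"
proof -
  have "card (freqs M :: (real ^ 'n) set) \<le> card ((UNIV :: 'n set) \<rightarrow>\<^sub>E {- int M..int M})"
    unfolding freqs_eq_image by (intro card_image_le finite_PiE) auto
  also have "\<dots> = (2 * M + 1) ^ CARD('n)"
    by (simp add: card_PiE nat_add_distrib nat_mult_distrib)
  finally show ?thesis .
qed

lemma freqs_mono: "M \<le> N \<Longrightarrow> freqs M \<subseteq> freqs N"
  unfolding freqs_def by (auto intro: order_trans)

lemma freqs_add: "k \<in> freqs M \<Longrightarrow> l \<in> freqs N \<Longrightarrow> k + l \<in> freqs (M + N)"
  by (auto simp: freqs_def intro!: Ints_add) (smt (verit))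

lemma zero_in_freqs [simp]: "0 \<in> freqs M"
  by (simp add: freqs_def)

lemma character_0 [simp]: "character 0 x = 1"
  by (simp add: character_def)

lemma character_add: "character (k + l) x = character k x * character l x"
  by (simp add: character_def cis_mult inner_add_left algebra_simps)

lemma cnj_character: "cnj (character k x) = character (- k) x"
  by (simp add: character_def cis_cnj)

lemma norm_character [simp]: "cmod (character k x) = 1"
  by (simp add: character_def)

lemma continuous_on_trig_sum [continuous_intros]:
  "continuous_on S f \<Longrightarrow> continuous_on S (\<lambda>x. trig_sum M c (f x))"
  unfolding trig_sum_def by (intro continuous_intros)

lemma integrable_unit_cell:
  fixes f :: "real ^ 'n \<Rightarrow> 'b :: euclidean_space"
  assumes "continuous_on UNIV f"
  shows "integrable (lebesgue_on unit_cell) f"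
proof -
  have "f absolutely_integrable_on cbox 0 1"
    by (intro absolutely_integrable_continuous continuous_on_subset[OF assms]) auto
  then have "f absolutely_integrable_on unit_cell"
    by (rule set_integrable_subset) (auto simp: unit_cell_def box_subset_cbox)
  then show ?thesis
    by (simp add: set_integrable_def integrable_restrict_space unit_cell_borel)
qed

lemma parseval:
  "(LINT x|lebesgue_on unit_cell. (cmod (trig_sum M c x))\<^sup>2) = (\<Sum>k\<in>freqs M. (cmod (c k))\<^sup>2)"
proof -
  have int: "integrable (lebesgue_on unit_cell) (character k)" for k :: "real ^ 'n"
    by (intro integrable_unit_cell continuous_intros)
  have "complex_of_real (LINT x|lebesgue_on unit_cell. (cmod (trig_sum M c x))\<^sup>2)
      = (LINT x|lebesgue_on unit_cell. trig_sum M c x * cnj (trig_sum M c x))"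
    by (simp add: complex_norm_square flip: integral_complex_of_real of_real_power)
  also have "\<dots> = (LINT x|lebesgue_on unit_cell.
      (\<Sum>k\<in>freqs M. \<Sum>l\<in>freqs M. c k * cnj (c l) * character (k - l) x))"
    by (simp add: trig_sum_def sum_product cnj_character character_add[of _ "- _", simplified] mult_ac)
  also have "\<dots> = (\<Sum>k\<in>freqs M. \<Sum>l\<in>freqs M. c k * cnj (c l) * (if k - l = 0 then 1 else 0))"
  proof -
    have "(LINT x|lebesgue_on unit_cell. character (k - l) x) = (if k - l = 0 then 1 else 0)"
      if "k \<in> freqs M" "l \<in> freqs M" for k l :: "real ^ 'n"
      using that by (intro integral_character) (auto simp: freqs_def)
    then have "(\<Sum>k\<in>freqs M. \<Sum>l\<in>freqs M. c k * cnj (c l) * (LINT x|lebesgue_on unit_cell. character (k - l) x))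
       = (\<Sum>k\<in>freqs M. \<Sum>l\<in>freqs M. c k * cnj (c l) * (if k - l = 0 then 1 else 0))"
      by (intro sum.cong refl arg_cong2[where f="(*)"]) blast
    then show ?thesis
      by (simp add: int)
  qed
  also have "\<dots> = complex_of_real (\<Sum>k\<in>freqs M. (cmod (c k))\<^sup>2)"
    by (simp add: if_distrib sum.delta' cong: if_cong) (simp add: complex_norm_square flip: of_real_power)
  finally show ?thesis
    using of_real_eq_iff by blast
qed

definition trig_poly :: "nat \<Rightarrow> (real ^ 'n \<Rightarrow> complex) \<Rightarrow> bool" where
  "trig_poly M u \<longleftrightarrow> (\<exists>c. u = trig_sum M c)"

text \<open>A trigonometric sum may be regarded as one of higher degree by padding its coefficients with zeros.\<close>

lemma trig_sum_mono:
  assumes "M \<le> N"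
  shows "trig_sum N (\<lambda>k. if k \<in> freqs M then c k else 0) = trig_sum M c"
proof
  fix x
  have "trig_sum N (\<lambda>k. if k \<in> freqs M then c k else 0) x =
      (\<Sum>k\<in>freqs M. (if k \<in> freqs M then c k else 0) * character k x)"
    unfolding trig_sum_def using freqs_mono[OF assms] by (intro sum.mono_neutral_right) auto
  then show "trig_sum N (\<lambda>k. if k \<in> freqs M then c k else 0) x = trig_sum M c x"
    by (simp add: trig_sum_def)
qed

lemma trig_poly_mono: "trig_poly M u \<Longrightarrow> M \<le> N \<Longrightarrow> trig_poly N u"
  unfolding trig_poly_def by (metis trig_sum_mono)

lemma trig_poly_character:
  assumes "k \<in> freqs M"
  shows "trig_poly M (\<lambda>x. a * character k x)"
  unfolding trig_poly_def
proof (intro exI ext)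
  show "a * character k x = trig_sum M (\<lambda>l. if l = k then a else 0) x" for x
    using assms by (simp add: trig_sum_def if_distrib[of "\<lambda>z. z * _"] cong: if_cong)
qed

lemma trig_poly_const: "trig_poly M (\<lambda>x. a)"
  using trig_poly_character[of 0 M a] by simp

lemma trig_poly_add:
  assumes "trig_poly M u" "trig_poly M v"
  shows "trig_poly M (\<lambda>x. u x + v x)"
proof -
  obtain c d where "u = trig_sum M c" "v = trig_sum M d"
    using assms by (auto simp: trig_poly_def)
  then have "(\<lambda>x. u x + v x) = trig_sum M (\<lambda>k. c k + d k)"
    by (simp add: trig_sum_def fun_eq_iff sum.distrib distrib_right)
  then show ?thesis unfolding trig_poly_def by blast
qed

lemma trig_poly_sum:
  "finite I \<Longrightarrow> (\<And>i. i \<in> I \<Longrightarrow> trig_poly M (u i)) \<Longrightarrow> trig_poly M (\<lambda>x. \<Sum>i\<in>I. u i x)"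
  by (induction I rule: finite_induct) (auto intro: trig_poly_const trig_poly_add)

lemma trig_poly_mult:
  assumes "trig_poly M u" "trig_poly N v"
  shows "trig_poly (M + N) (\<lambda>x. u x * v x)"
proof -
  obtain c d where uv: "u = trig_sum M c" "v = trig_sum N d"
    using assms by (auto simp: trig_poly_def)
  have "trig_poly (M + N) (\<lambda>x. \<Sum>k\<in>freqs M. \<Sum>l\<in>freqs N. (c k * d l) * character (k + l) x)"
    by (intro trig_poly_sum trig_poly_character freqs_add) auto
  also have "(\<lambda>x. \<Sum>k\<in>freqs M. \<Sum>l\<in>freqs N. (c k * d l) * character (k + l) x) = (\<lambda>x. u x * v x)"
    by (simp add: uv trig_sum_def sum_product character_add mult_ac)
  finally show ?thesis .
qed

section \<open>The nondivergence equation with trigonometric coefficients\<close>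

text \<open>The entries of \<open>D\<^sup>2 \<Delta>\<^sup>-\<^sup>1 u\<close>, where \<open>u\<close> has coefficients \<open>f\<close>: a second derivative multiplies the
  coefficient at \<open>k\<close> by \<open>- 4 \<pi>\<^sup>2 k\<^sub>i k\<^sub>j\<close> and the inverse Laplacian divides it by
  \<open>- 4 \<pi>\<^sup>2 \<bar>k\<bar>\<^sup>2\<close>. At \<open>k = 0\<close> the quotient is \<open>0\<close>, so that a constant term contributes nothing.\<close>

definition hessian_sum :: "nat \<Rightarrow> (real ^ 'n \<Rightarrow> complex) \<Rightarrow> 'n \<Rightarrow> 'n \<Rightarrow> real ^ 'n \<Rightarrow> complex" where
  "hessian_sum M f i j = trig_sum M (\<lambda>k. of_real (k $ i * k $ j / (k \<bullet> k)) * f k)"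

definition coeff_norm :: "nat \<Rightarrow> (real ^ 'n \<Rightarrow> complex) \<Rightarrow> real" where
  "coeff_norm M f = L2_set (\<lambda>k. cmod (f k)) (freqs M)"

lemma coeff_norm_nonneg [simp]: "0 \<le> coeff_norm M f"
  by (simp add: coeff_norm_def L2_set_nonneg)

lemma coeff_norm_triangle: "coeff_norm M (\<lambda>k. f k + g k) \<le> coeff_norm M f + coeff_norm M g"
  unfolding coeff_norm_def
  by (rule order_trans[OF L2_set_mono L2_set_triangle_ineq]) (auto intro: norm_triangle_ineq)

lemma coeff_norm_square: "(coeff_norm M f)\<^sup>2 = (\<Sum>k\<in>freqs M. (cmod (f k))\<^sup>2)"
  by (simp add: coeff_norm_def L2_set_def sum_nonneg)

lemma trace_hessian_sum:
  assumes "f 0 = 0"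
  shows "(\<Sum>i\<in>UNIV. hessian_sum M f i i x) = trig_sum M f x"
proof -
  have "(\<Sum>i\<in>UNIV. k $ i * k $ i / (k \<bullet> k)) *\<^sub>R f k = f k" for k :: "real ^ 'a"
  proof (cases "k = 0")
    case False
    have "(\<Sum>i\<in>UNIV. k $ i * k $ i / (k \<bullet> k)) = (k \<bullet> k) / (k \<bullet> k)"
      by (simp only: sum_divide_distrib[symmetric]) (simp add: inner_vec_def)
    then show ?thesis using False by simp
  qed (simp add: assms)
  then have "(\<Sum>i\<in>UNIV. of_real (k $ i * k $ i / (k \<bullet> k)) * f k) = f k" for k :: "real ^ 'a"
    by (simp only: scaleR_conv_of_real of_real_sum sum_distrib_right)
  then show ?thesis
    unfolding hessian_sum_def trig_sum_def
    by (subst sum.swap) (simp only: sum_distrib_right[symmetric])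
qed

text \<open>The operator \<open>D\<^sup>2 \<Delta>\<^sup>-\<^sup>1\<close> is an isometry on functions of mean zero, because the matrix
  \<open>k k\<^sup>T / \<bar>k\<bar>\<^sup>2\<close> has Frobenius norm \<open>1\<close>.\<close>

lemma integral_norm_hessian_sum:
  assumes "f 0 = 0"
  shows "(LINT x|lebesgue_on unit_cell. (\<Sum>i\<in>UNIV. \<Sum>j\<in>UNIV. (cmod (hessian_sum M f i j x))\<^sup>2)) = (coeff_norm M f)\<^sup>2"
proof -
  have "integrable (lebesgue_on unit_cell) (\<lambda>x. (cmod (hessian_sum M f i j x))\<^sup>2)" for i j
    unfolding hessian_sum_def by (intro integrable_unit_cell continuous_intros)
  then have "(LINT x|lebesgue_on unit_cell. (\<Sum>i\<in>UNIV. \<Sum>j\<in>UNIV. (cmod (hessian_sum M f i j x))\<^sup>2))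
     = (\<Sum>i\<in>UNIV. \<Sum>j\<in>UNIV. \<Sum>k\<in>freqs M. (cmod (of_real (k $ i * k $ j / (k \<bullet> k)) * f k))\<^sup>2)"
    by (simp add: hessian_sum_def parseval)
  also have "\<dots> = (\<Sum>k\<in>freqs M. \<Sum>i\<in>UNIV. \<Sum>j\<in>UNIV. (cmod (of_real (k $ i * k $ j / (k \<bullet> k)) * f k))\<^sup>2)"
  proof -
    have "(\<Sum>j\<in>UNIV. \<Sum>k\<in>freqs M. h i j k) = (\<Sum>k\<in>freqs M. \<Sum>j\<in>UNIV. h i j k)" for h :: "'a \<Rightarrow> 'a \<Rightarrow> real ^ 'a \<Rightarrow> real" and i
      by (rule sum.swap)
    moreover have "(\<Sum>i\<in>UNIV. \<Sum>k\<in>freqs M. h i k) = (\<Sum>k\<in>freqs M. \<Sum>i\<in>UNIV. h i k)" for h :: "'a \<Rightarrow> real ^ 'a \<Rightarrow> real"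
      by (rule sum.swap)
    ultimately show ?thesis by simp
  qed
  also have "\<dots> = (\<Sum>k\<in>freqs M. (cmod (f k))\<^sup>2)"
  proof (rule sum.cong[OF refl])
    fix k :: "real ^ 'a"
    have "(\<Sum>i\<in>UNIV. \<Sum>j\<in>UNIV. (k $ i)\<^sup>2 * (k $ j)\<^sup>2) = (k \<bullet> k)\<^sup>2"
      by (simp add: power2_eq_square inner_vec_def sum_product)
    then have "(\<Sum>i\<in>UNIV. \<Sum>j\<in>UNIV. ((k $ i)\<^sup>2 * (k $ j)\<^sup>2 / (k \<bullet> k)\<^sup>2) * (cmod (f k))\<^sup>2) = (cmod (f k))\<^sup>2"
      using assms by (cases "k = 0") (auto simp: sum_distrib_right[symmetric] sum_divide_distrib[symmetric])
    then show "(\<Sum>i\<in>UNIV. \<Sum>j\<in>UNIV. (cmod (of_real (k $ i * k $ j / (k \<bullet> k)) * f k))\<^sup>2) = (cmod (f k))\<^sup>2"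
      by (simp add: norm_mult norm_divide power_mult_distrib power_divide)
  qed
  finally show ?thesis by (simp add: coeff_norm_square)
qed

text \<open>One step of the Neumann series. The new function \<open>f'\<close> represents \<open>- T f\<close> without its mean, which is split
  off as the constant \<open>a\<close>. The factor \<open>q\<close> is the pointwise Cauchy-Schwarz inequality for
  \<open>(B - I) : D\<^sup>2 \<Delta>\<^sup>-\<^sup>1 f\<close> combined with the isometry property; the degree grows by that of \<open>B\<close>.\<close>

lemma cordes_contraction:
  fixes B :: "real ^ 'n \<Rightarrow> real ^ 'n ^ 'n"
  assumes B: "\<And>i j. trig_poly R (\<lambda>x. of_real (B x $ i $ j))"
    and q: "\<And>x. norm (B x - mat 1) \<le> q" and f: "f 0 = 0"
  obtains f' a where "f' 0 = 0" "coeff_norm (M + R) f' \<le> q * coeff_norm M f"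
    "\<And>x. (\<Sum>i\<in>UNIV. \<Sum>j\<in>UNIV. of_real (B x $ i $ j) * hessian_sum M f i j x)
        = trig_sum M f x - trig_sum (M + R) f' x + a"
proof -
  have q0: "0 \<le> q" using q[of 0] norm_ge_zero order_trans by blast
  define C where "C x = B x - mat 1" for x
  define T where "T x = (\<Sum>i\<in>UNIV. \<Sum>j\<in>UNIV. of_real (C x $ i $ j) * hessian_sum M f i j x)" for x
  have "trig_poly R (\<lambda>x. of_real (B x $ i $ j) + of_real (- (mat 1 :: real ^ 'n ^ 'n) $ i $ j))" for i j
    by (intro trig_poly_add B trig_poly_const)
  then have "trig_poly R (\<lambda>x. of_real (C x $ i $ j))" for i j
    by (simp add: C_def)
  then have "trig_poly (R + M) T"
    unfolding T_def by (intro trig_poly_sum trig_poly_mult) (auto simp: trig_poly_def hessian_sum_def)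
  then obtain e where e: "T = trig_sum (M + R) e"
    by (auto simp: trig_poly_def add.commute)
  define f' where "f' k = (if k = 0 then 0 else - e k)" for k
  have B_eq: "(\<Sum>i\<in>UNIV. \<Sum>j\<in>UNIV. of_real (B x $ i $ j) * hessian_sum M f i j x) = trig_sum M f x + T x" for x
  proof -
    have "of_real (B x $ i $ j) * hessian_sum M f i j x =
       (if i = j then hessian_sum M f i i x else 0) + of_real (C x $ i $ j) * hessian_sum M f i j x" for i j
      by (simp add: C_def mat_def algebra_simps)
    then show ?thesis
      by (simp add: sum.distrib T_def trace_hessian_sum[where f = f, OF f])
  qed
  have "trig_sum (M + R) f' x = - (trig_sum (M + R) e x - e 0)" for x
  proof -
    have "trig_sum (M + R) f' x = (\<Sum>k\<in>freqs (M + R). (if k = 0 then e 0 else 0) - e k * character k x)"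
      unfolding trig_sum_def by (intro sum.cong) (auto simp: f'_def)
    then show ?thesis by (simp add: sum_subtractf trig_sum_def)
  qed
  then have "(\<Sum>i\<in>UNIV. \<Sum>j\<in>UNIV. of_real (B x $ i $ j) * hessian_sum M f i j x)
        = trig_sum M f x - trig_sum (M + R) f' x + e 0" for x
    by (simp add: B_eq e)
  moreover have "coeff_norm (M + R) f' \<le> q * coeff_norm M f"
  proof (rule power2_le_imp_le)
    have T_le: "(cmod (T x))\<^sup>2 \<le> q\<^sup>2 * (\<Sum>i\<in>UNIV. \<Sum>j\<in>UNIV. (cmod (hessian_sum M f i j x))\<^sup>2)" for x
    proof -
      have "cmod (T x) \<le> (\<Sum>p\<in>UNIV. \<bar>\<bar>C x $ fst p $ snd p\<bar> * cmod (hessian_sum M f (fst p) (snd p) x)\<bar>)"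
        unfolding T_def sum.cartesian_product UNIV_Times_UNIV
        by (rule order_trans[OF norm_sum]) (simp add: norm_mult case_prod_beta)
      also have "\<dots> \<le> L2_set (\<lambda>p. \<bar>C x $ fst p $ snd p\<bar>) UNIV * L2_set (\<lambda>p. cmod (hessian_sum M f (fst p) (snd p) x)) UNIV"
        using L2_set_mult_ineq[of "\<lambda>p. \<bar>C x $ fst p $ snd p\<bar>" "\<lambda>p. cmod (hessian_sum M f (fst p) (snd p) x)" UNIV]
        by (simp add: abs_mult)
      also have "L2_set (\<lambda>p. \<bar>C x $ fst p $ snd p\<bar>) UNIV = norm (C x)"
        unfolding L2_set_def matrix_norm_eq matrix_inner_eq sum.cartesian_product UNIV_Times_UNIV
        by (simp add: case_prod_beta power2_eq_square)
      also have "norm (C x) * L2_set (\<lambda>p. cmod (hessian_sum M f (fst p) (snd p) x)) UNIV \<le>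
          q * L2_set (\<lambda>p. cmod (hessian_sum M f (fst p) (snd p) x)) UNIV"
        using q[of x] by (intro mult_right_mono) (auto simp: C_def L2_set_nonneg)
      finally have "(cmod (T x))\<^sup>2 \<le> (q * L2_set (\<lambda>p. cmod (hessian_sum M f (fst p) (snd p) x)) UNIV)\<^sup>2"
        by (intro power_mono) auto
      then show ?thesis
        by (simp add: power_mult_distrib L2_set_def sum_nonneg sum.cartesian_product case_prod_beta)
    qed
    have "(coeff_norm (M + R) f')\<^sup>2 \<le> (\<Sum>k\<in>freqs (M + R). (cmod (e k))\<^sup>2)"
      unfolding coeff_norm_square by (intro sum_mono) (auto simp: f'_def)
    also have "\<dots> = (LINT x|lebesgue_on unit_cell. (cmod (T x))\<^sup>2)"
      by (simp add: parseval e)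
    also have "\<dots> \<le> (LINT x|lebesgue_on unit_cell. q\<^sup>2 * (\<Sum>i\<in>UNIV. \<Sum>j\<in>UNIV. (cmod (hessian_sum M f i j x))\<^sup>2))"
      unfolding e hessian_sum_def using T_le[unfolded e hessian_sum_def]
      by (intro integral_mono integrable_unit_cell continuous_intros)
    also have "\<dots> = (q * coeff_norm M f)\<^sup>2"
      by (simp add: integral_norm_hessian_sum[where f = f, OF f] power_mult_distrib)
    finally show "(coeff_norm (M + R) f')\<^sup>2 \<le> (q * coeff_norm M f)\<^sup>2" .
  qed (use q0 in simp)
  moreover have "f' 0 = 0" by (simp add: f'_def)
  ultimately show ?thesis using that by blast
qed

text \<open>Here \<open>f\<close> is the partial sum of the first \<open>J\<close> terms of the series, and \<open>u\<close> is the next term, which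
  by telescoping is also the remainder.\<close>

lemma neumann_iterates:
  fixes B :: "real ^ 'n \<Rightarrow> real ^ 'n ^ 'n"
  assumes B: "\<And>i j. trig_poly R (\<lambda>x. of_real (B x $ i $ j))"
    and q: "\<And>x. norm (B x - mat 1) \<le> q" and g: "g 0 = 0"
  shows "\<exists>f u a. f 0 = 0 \<and> u 0 = 0 \<and> coeff_norm (M + J * R) u \<le> q ^ J * coeff_norm M g \<and>
    coeff_norm (M + J * R) f \<le> (\<Sum>j<J. q ^ j) * coeff_norm M g \<and>
    (\<forall>x. (\<Sum>i\<in>UNIV. \<Sum>j\<in>UNIV. of_real (B x $ i $ j) * hessian_sum (M + J * R) f i j x)
        = trig_sum M g x - trig_sum (M + J * R) u x + a)"
proof (induction J)
  case 0
  have "hessian_sum M (\<lambda>k. 0) i j x = 0" for i j and x :: "real ^ 'n"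
    by (simp add: hessian_sum_def trig_sum_def)
  moreover have "coeff_norm M (\<lambda>k :: real ^ 'n. 0) = 0"
    by (simp add: coeff_norm_def L2_set_def)
  ultimately show ?case
    by (intro exI[of _ "\<lambda>k. 0"] exI[of _ g] exI[of _ 0]) (use g in simp)
next
  case (Suc J)
  define N where "N = M + J * R"
  have NS: "M + Suc J * R = N + R" by (simp add: N_def)
  have q0: "0 \<le> q" using q[of 0] norm_ge_zero order_trans by blast
  obtain f u a where f: "f 0 = 0" and u: "u 0 = 0" "coeff_norm N u \<le> q ^ J * coeff_norm M g"
    and fle: "coeff_norm N f \<le> (\<Sum>j<J. q ^ j) * coeff_norm M g"
    and eq: "\<And>x. (\<Sum>i\<in>UNIV. \<Sum>j\<in>UNIV. of_real (B x $ i $ j) * hessian_sum N f i j x)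
        = trig_sum M g x - trig_sum N u x + a"
    using Suc unfolding N_def by blast
  obtain u' a' where u': "u' 0 = 0" "coeff_norm (N + R) u' \<le> q * coeff_norm N u"
    and eq': "\<And>x. (\<Sum>i\<in>UNIV. \<Sum>j\<in>UNIV. of_real (B x $ i $ j) * hessian_sum N u i j x)
        = trig_sum N u x - trig_sum (N + R) u' x + a'"
    using cordes_contraction[where M = N and f = u and B = B, OF B q u(1)] by blast
  define h where "h k = (if k \<in> freqs N then f k + u k else 0)" for k
  have hess: "hessian_sum (N + R) h i j x = hessian_sum N f i j x + hessian_sum N u i j x" for i j x
  proof -
    have "hessian_sum (N + R) h i j = trig_sum N (\<lambda>k. of_real (k $ i * k $ j / (k \<bullet> k)) * (f k + u k))"
      unfolding hessian_sum_def h_def by (subst trig_sum_mono[of N "N + R", symmetric])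
        (auto intro!: arg_cong[where f="trig_sum _"])
    then show ?thesis
      by (simp add: hessian_sum_def trig_sum_def distrib_left distrib_right sum.distrib)
  qed
  have "coeff_norm (N + R) h = coeff_norm N (\<lambda>k. f k + u k)"
    unfolding coeff_norm_def L2_set_def h_def
    by (intro arg_cong[where f=sqrt] sum.mono_neutral_cong_right) (auto simp: freqs_mono)
  also have "\<dots> \<le> coeff_norm N f + coeff_norm N u"
    by (rule coeff_norm_triangle)
  also have "\<dots> \<le> (\<Sum>j<Suc J. q ^ j) * coeff_norm M g"
    using fle u(2) by (simp add: algebra_simps)
  finally have "coeff_norm (N + R) h \<le> (\<Sum>j<Suc J. q ^ j) * coeff_norm M g" .
  moreover have "coeff_norm (N + R) u' \<le> q ^ Suc J * coeff_norm M g"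
    using order_trans[OF u'(2) mult_left_mono[OF u(2) q0]] by (simp add: mult_ac)
  moreover have "(\<Sum>i\<in>UNIV. \<Sum>j\<in>UNIV. of_real (B x $ i $ j) * hessian_sum (N + R) h i j x)
        = trig_sum M g x - trig_sum (N + R) u' x + (a + a')" for x
    using eq[of x] eq'[of x] by (simp add: hess distrib_left sum.distrib)
  moreover have "h 0 = 0" by (simp add: h_def f u)
  ultimately show ?case unfolding NS using u'(1) by blast
qed

text \<open>The supremum is at most the sum of the absolute values of the coefficients, which Cauchy-Schwarz bounds by the root of
  their number times the \<open>L\<^sup>2\<close> norm. Polynomial growth in the degree is all that matters.\<close>

lemma norm_trig_sum_le:
  fixes u :: "real ^ 'n \<Rightarrow> complex"
  shows "cmod (trig_sum M u x) \<le> (2 * real M + 1) ^ CARD('n) * coeff_norm M u"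
proof -
  have "cmod (trig_sum M u x) \<le> (\<Sum>k\<in>freqs M. \<bar>1\<bar> * \<bar>cmod (u k)\<bar>)"
    unfolding trig_sum_def by (rule order_trans[OF norm_sum]) (simp add: norm_mult)
  also have "\<dots> \<le> L2_set (\<lambda>k. 1) (freqs M :: (real ^ 'n) set) * coeff_norm M u"
    unfolding coeff_norm_def by (rule L2_set_mult_ineq)
  also have "\<dots> \<le> (2 * real M + 1) ^ CARD('n) * coeff_norm M u"
  proof (intro mult_right_mono coeff_norm_nonneg)
    have "real (card (freqs M :: (real ^ 'n) set)) \<le> real ((2 * M + 1) ^ CARD('n))"
      by (intro of_nat_mono card_freqs_le)
    moreover have "1 \<le> (2 * real M + 1) ^ CARD('n)" by simp
    ultimately have "real (card (freqs M :: (real ^ 'n) set)) \<le> ((2 * real M + 1) ^ CARD('n))\<^sup>2"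
      using self_le_power[of "(2 * real M + 1) ^ CARD('n)" 2] by (simp add: add.commute)
    then show "L2_set (\<lambda>k. 1) (freqs M :: (real ^ 'n) set) \<le> (2 * real M + 1) ^ CARD('n)"
      by (auto simp: L2_set_def intro!: real_le_lsqrt)
  qed
  finally show ?thesis .
qed

lemma power_times_geometric_tendsto_0:
  fixes q :: real
  assumes "0 \<le> q" "q < 1" "0 < n"
  shows "(\<lambda>J. (a + b * real J) ^ n * q ^ J) \<longlonglongrightarrow> 0"
proof -
  \<comment> \<open>Splitting \<open>q ^ J\<close> into \<open>n\<close> equal factors reduces the claim to degree one.\<close>
  define p where "p = root n q"
  have p: "0 \<le> p" "p < 1" "p ^ n = q" using assms by (auto simp: p_def)
  have "(\<lambda>J. (a * p ^ J + b * (real J * p ^ J)) ^ n) \<longlonglongrightarrow> (a * 0 + b * 0) ^ n"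
    by (intro tendsto_intros LIMSEQ_power_zero powser_times_n_limit_0) (use p in auto)
  moreover have "(a * p ^ J + b * (real J * p ^ J)) ^ n = (a + b * real J) ^ n * q ^ J" for J
  proof -
    have "(a * p ^ J + b * (real J * p ^ J)) ^ n = ((a + b * real J) * p ^ J) ^ n"
      by (simp add: algebra_simps)
    also have "\<dots> = (a + b * real J) ^ n * (p ^ n) ^ J"
      by (simp add: power_mult_distrib mult.commute flip: power_mult)
    finally show ?thesis by (simp add: p)
  qed
  ultimately show ?thesis using assms by (simp add: zero_power)
qed

text \<open>The remainder decays geometrically in \<open>L\<^sup>2\<close> and its degree grows only linearly, so it also decays
  uniformly. The bound on \<open>f\<close> does not depend on the accuracy \<open>e\<close> or on the degrees.\<close>

lemma approximate_solution:
  fixes B :: "real ^ 'n \<Rightarrow> real ^ 'n ^ 'n"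
  assumes B: "\<And>i j. trig_poly R (\<lambda>x. of_real (B x $ i $ j))"
    and q: "\<And>x. norm (B x - mat 1) \<le> q" "q < 1" and e: "0 < e"
  obtains N f a where "f 0 = 0" "coeff_norm N f \<le> coeff_norm M g / (1 - q)"
    "\<And>x. cmod ((\<Sum>i\<in>UNIV. \<Sum>j\<in>UNIV. of_real (B x $ i $ j) * hessian_sum N f i j x) - (trig_sum M g x - a)) \<le> e"
proof -
  have q0: "0 \<le> q" using q(1)[of 0] norm_ge_zero order_trans by blast
  define g' where "g' k = (if k = 0 then 0 else g k)" for k
  have g'0: "g' 0 = 0" by (simp add: g'_def)
  have g'_le: "coeff_norm M g' \<le> coeff_norm M g"
    unfolding coeff_norm_def by (intro L2_set_mono) (auto simp: g'_def)
  have g'_eq: "trig_sum M g' x = trig_sum M g x - g 0" for x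
  proof -
    have "trig_sum M g' x = (\<Sum>k\<in>freqs M. g k * character k x - (if k = 0 then g 0 else 0))"
      unfolding trig_sum_def by (intro sum.cong) (auto simp: g'_def)
    then show ?thesis by (simp add: sum_subtractf trig_sum_def)
  qed
  have "(\<lambda>J. ((2 * real M + 1) + 2 * real R * real J) ^ CARD('n) * q ^ J * coeff_norm M g') \<longlonglongrightarrow> 0 * coeff_norm M g'"
    by (intro tendsto_mult power_times_geometric_tendsto_0 q0 q(2) tendsto_const) simp
  then have "\<forall>\<^sub>F J in sequentially. ((2 * real M + 1) + 2 * real R * real J) ^ CARD('n) * q ^ J * coeff_norm M g' < e"
    using e by (auto dest: order_tendstoD(2))
  then obtain J where J: "((2 * real M + 1) + 2 * real R * real J) ^ CARD('n) * q ^ J * coeff_norm M g' < e"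
    by (auto simp: eventually_sequentially)
  define N where "N = M + J * R"
  obtain f u a where f: "f 0 = 0" and u: "coeff_norm N u \<le> q ^ J * coeff_norm M g'"
    and fle: "coeff_norm N f \<le> (\<Sum>j<J. q ^ j) * coeff_norm M g'"
    and eq: "\<And>x. (\<Sum>i\<in>UNIV. \<Sum>j\<in>UNIV. of_real (B x $ i $ j) * hessian_sum N f i j x)
        = trig_sum M g' x - trig_sum N u x + a"
    using neumann_iterates[where M = M and J = J and B = B and g = g', OF B q(1) g'0] unfolding N_def by blast
  have "cmod (trig_sum N u x) \<le> e" for x
  proof -
    have "cmod (trig_sum N u x) \<le> (2 * real N + 1) ^ CARD('n) * (q ^ J * coeff_norm M g')"
      by (rule order_trans[OF norm_trig_sum_le mult_left_mono[OF u]]) simp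
    also have "\<dots> = ((2 * real M + 1) + 2 * real R * real J) ^ CARD('n) * q ^ J * coeff_norm M g'"
      by (simp add: N_def algebra_simps)
    finally show ?thesis using J by simp
  qed
  then have "cmod ((\<Sum>i\<in>UNIV. \<Sum>j\<in>UNIV. of_real (B x $ i $ j) * hessian_sum N f i j x) - (trig_sum M g x - (g 0 - a))) \<le> e" for x
    by (simp add: eq g'_eq)
  moreover have "coeff_norm N f \<le> coeff_norm M g / (1 - q)"
  proof -
    have "(\<Sum>j<J. q ^ j) \<le> 1 / (1 - q)"
      using q0 q(2) by (simp add: sum_gp_strict divide_simps)
    then have "(\<Sum>j<J. q ^ j) * coeff_norm M g' \<le> 1 / (1 - q) * coeff_norm M g"
      using g'_le q(2) by (intro mult_mono) auto
    then show ?thesis using fle by simp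
  qed
  ultimately show ?thesis using that f by blast
qed

section \<open>Trigonometric sums as periodic Sobolev functions\<close>

lemma has_derivative_character:
  "(character k has_derivative (\<lambda>h. of_real (2 * pi * (k \<bullet> h)) * \<i> * character k x)) (at x)"
proof -
  have "((\<lambda>x. exp (\<i> * of_real (2 * pi * (k \<bullet> x)))) has_derivative
      (\<lambda>h. \<i> * of_real (2 * pi * (k \<bullet> h)) * exp (\<i> * of_real (2 * pi * (k \<bullet> x))))) (at x)"
    by (rule has_derivative_eq_rhs[OF has_derivative_compose[OF _ DERIV_exp[unfolded has_field_derivative_def]]])
       (auto intro!: derivative_eq_intros bounded_linear.has_derivative[OF bounded_linear_of_real] simp: mult.commute)
  then show ?thesis
    by (simp add: character_def[abs_def] cis_conv_exp mult_ac)
qed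

lemma has_derivative_Re_trig_sum:
  "((\<lambda>x. Re (trig_sum N c x)) has_derivative
    (\<lambda>h. Re (trig_sum N (\<lambda>k. of_real (2 * pi * (k \<bullet> h)) * \<i> * c k) x))) (at x)"
proof -
  have "((\<lambda>x. Re (\<Sum>k\<in>freqs N. c k * character k x)) has_derivative
    (\<lambda>h. Re (\<Sum>k\<in>freqs N. c k * (of_real (2 * pi * (k \<bullet> h)) * \<i> * character k x)))) (at x)"
    by (intro has_derivative_Re has_derivative_sum has_derivative_mult_right has_derivative_character)
  then show ?thesis
    by (simp add: trig_sum_def[abs_def] mult_ac)
qed

lemma partial_deriv_Re_trig_sum:
  "partial_deriv i (\<lambda>x. Re (trig_sum N c x))
    = (\<lambda>x. Re (trig_sum N (\<lambda>k. of_real (2 * pi * k $ i) * \<i> * c k) x))"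
  unfolding partial_deriv_def
  by (simp add: frechet_derivative_at[OF has_derivative_Re_trig_sum, symmetric] cart_eq_inner_axis fun_eq_iff)

lemma integral_translate:
  fixes f :: "real ^ 'n \<Rightarrow> real"
  assumes "f \<in> borel_measurable borel"
  shows "(LINT x|lborel. f (x + a)) = (LINT x|lborel. f x)"
proof -
  have "(LINT x|lborel. f x) = (LINT x|distr lborel borel ((+) a). f x)"
    by (simp add: lborel_distr_plus)
  also have "\<dots> = (LINT x|lborel. f (x + a))"
    by (subst integral_distr) (use assms in \<open>auto simp: add.commute\<close>)
  finally show ?thesis by simp
qed

text \<open>The integrals of all difference quotients of \<open>F\<close> vanish by translation invariance, and the quotients
  converge to the derivative, dominated by its maximum on a bounded set.\<close>

lemma integral_partial_deriv_eq_0: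
  fixes F :: "real ^ 'n \<Rightarrow> real"
  assumes diff: "\<And>x. F differentiable at x" and cont: "continuous_on UNIV (partial_deriv i F)"
    and K: "compact K" and supp: "\<And>x. x \<notin> K \<Longrightarrow> F x = 0"
  shows "(LINT x|lebesgue. partial_deriv i F x) = 0"
proof -
  define e :: "real ^ 'n" where "e = axis i 1"
  have [simp]: "norm e = 1" by (simp add: e_def)
  have contF: "continuous_on UNIV F"
    using diff differentiable_imp_continuous_within by (fastforce simp: continuous_on_eq_continuous_within)
  have Fm [measurable]: "F \<in> borel_measurable borel"
    by (rule borel_measurable_continuous_onI[OF contF])
  have dm [measurable]: "partial_deriv i F \<in> borel_measurable borel"
    by (rule borel_measurable_continuous_onI[OF cont])
  have line: "((\<lambda>t. F (x + t *\<^sub>R e)) has_real_derivative partial_deriv i F (x + t *\<^sub>R e)) (at t)" for x t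
  proof -
    have "(F has_derivative frechet_derivative F (at (x + t *\<^sub>R e))) (at (x + t *\<^sub>R e))"
      using diff frechet_derivative_works by blast
    then have "((F \<circ> (\<lambda>t. x + t *\<^sub>R e)) has_derivative
        (frechet_derivative F (at (x + t *\<^sub>R e)) \<circ> (\<lambda>h. h *\<^sub>R e))) (at t)"
      by (intro diff_chain_at) (auto intro!: derivative_eq_intros)
    moreover have "frechet_derivative F (at (x + t *\<^sub>R e)) (h *\<^sub>R e) = h * partial_deriv i F (x + t *\<^sub>R e)" for h
      using linear_frechet_derivative[OF diff] by (simp add: partial_deriv_def e_def linear_cmul)
    ultimately show ?thesis
      unfolding has_field_derivative_def o_def
      by (elim has_derivative_eq_rhs) (simp add: fun_eq_iff)
  qed
  obtain r where r: "K \<subseteq> cball 0 r"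
    using bounded_subset_ballD[OF compact_imp_bounded[OF K], of 0] ball_subset_cball by (meson subset_trans)
  obtain C where C: "\<And>x. x \<in> cball 0 (r + 2) \<Longrightarrow> \<bar>partial_deriv i F x\<bar> \<le> C"
  proof -
    have "bounded (partial_deriv i F ` cball 0 (r + 2))"
      by (intro compact_imp_bounded compact_continuous_image continuous_on_subset[OF cont]) auto
    then obtain c where "\<forall>y\<in>partial_deriv i F ` cball 0 (r + 2). norm y \<le> c"
      unfolding bounded_iff by blast
    then show ?thesis by (intro that[of c]) simp
  qed
  define G where "G n x = (F (x + (1 / real (Suc n)) *\<^sub>R e) - F x) * real (Suc n)" for n x
  have Fint: "integrable lborel F"
  proof -
    have "integrable lborel (\<lambda>x. indicator (cball 0 r) x *\<^sub>R F x)"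
      by (intro borel_integrable_compact continuous_on_subset[OF contF]) auto
    moreover have "(\<lambda>x. indicator (cball 0 r) x *\<^sub>R F x) = F"
    proof
      show "indicator (cball 0 r) x *\<^sub>R F x = F x" for x
        by (cases "x \<in> K") (use r supp[of x] in auto)
    qed
    ultimately show ?thesis by simp
  qed
  have Fint': "integrable lborel (\<lambda>x. F (x + a))" for a
    using integrable_distr_eq[of "(+) a" lborel borel F] Fint
    by (simp add: lborel_distr_plus add.commute)
  have G0: "(LINT x|lborel. G n x) = 0" for n
    unfolding G_def using Fint Fint' by (simp add: integral_translate)
  have "(\<lambda>n. LINT x|lborel. G n x) \<longlonglongrightarrow> (LINT x|lborel. partial_deriv i F x)"
  proof (rule integral_dominated_convergence)
    show "integrable lborel (\<lambda>x. indicator (cball 0 (r + 1)) x *\<^sub>R C)"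
      by (rule borel_integrable_compact) auto
    show "AE x in lborel. (\<lambda>n. G n x) \<longlonglongrightarrow> partial_deriv i F x"
    proof (rule AE_I2)
      fix x
      have "((\<lambda>h. (F (x + h *\<^sub>R e) - F x) / h) \<longlongrightarrow> partial_deriv i F x) (at 0)"
        using line[of x 0] by (simp add: DERIV_def)
      moreover have "filterlim (\<lambda>n. 1 / real (Suc n)) (at 0) sequentially"
        using LIMSEQ_Suc[OF lim_1_over_n] by (auto simp: filterlim_at)
      ultimately have "(\<lambda>n. (F (x + (1 / real (Suc n)) *\<^sub>R e) - F x) / (1 / real (Suc n))) \<longlonglongrightarrow> partial_deriv i F x"
        by (rule filterlim_compose)
      then show "(\<lambda>n. G n x) \<longlonglongrightarrow> partial_deriv i F x"
        by (simp add: G_def)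
    qed
    show "AE x in lborel. norm (G n x) \<le> indicator (cball 0 (r + 1)) x *\<^sub>R C" for n
    proof (rule AE_I2)
      fix x
      obtain t where t: "0 < t" "t < 1 / real (Suc n)"
        and mv: "F (x + (1 / real (Suc n)) *\<^sub>R e) - F (x + 0 *\<^sub>R e)
            = (1 / real (Suc n) - 0) * partial_deriv i F (x + t *\<^sub>R e)"
        using MVT2[of 0 "1 / real (Suc n)" "\<lambda>t. F (x + t *\<^sub>R e)" "\<lambda>t. partial_deriv i F (x + t *\<^sub>R e)"] line
        by auto
      have "1 / real (Suc n) \<le> 1" by (simp add: divide_simps)
      with t(2) have t1: "t \<le> 1" "1 / real (Suc n) \<le> 1" by linarith+
      have Geq: "G n x = partial_deriv i F (x + t *\<^sub>R e)"
        using mv by (simp add: G_def field_simps)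
      show "norm (G n x) \<le> indicator (cball 0 (r + 1)) x *\<^sub>R C"
      proof (cases "x \<in> cball 0 (r + 1)")
        case True
        then have "x + t *\<^sub>R e \<in> cball 0 (r + 2)"
          using t(1) t1(1) norm_triangle_ineq[of x "t *\<^sub>R e"] by simp
        then show ?thesis using C True by (simp add: Geq)
      next
        case False
        have "x + s *\<^sub>R e \<notin> K" if "0 \<le> s" "s \<le> 1" for s
        proof
          assume "x + s *\<^sub>R e \<in> K"
          then have "norm (x + s *\<^sub>R e) \<le> r" using r by auto
          then show False
            using False that norm_triangle_ineq4[of "x + s *\<^sub>R e" "s *\<^sub>R e"] by simp
        qed
        from this[of 0] this[of "1 / real (Suc n)"] have "G n x = 0"
          using t1(2) by (simp add: G_def supp)
        then show ?thesis using False by simp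
      qed
    qed
  qed (simp_all add: G_def)
  then have "(LINT x|lborel. partial_deriv i F x) = 0"
    using G0 LIMSEQ_const_iff by (simp add: tendsto_const_iff)
  then show ?thesis
    by (simp add: integral_completion)
qed

lemma partial_deriv_mult:
  assumes "u differentiable at x" "v differentiable at x"
  shows "partial_deriv i (\<lambda>x. u x * v x) x = u x * partial_deriv i v x + partial_deriv i u x * v x"
proof -
  have "((\<lambda>x. u x * v x) has_derivative
     (\<lambda>h. u x * frechet_derivative v (at x) h + frechet_derivative u (at x) h * v x)) (at x)"
    using assms by (intro has_derivative_mult) (auto simp: frechet_derivative_works[symmetric])
  then show ?thesis
    unfolding partial_deriv_def by (simp add: frechet_derivative_at[symmetric])
qed

lemma test_function_iter_partial:
  fixes \<psi> :: "real ^ 'n \<Rightarrow> real"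
  assumes "test_function \<psi>"
  shows "iter_partial js \<psi> differentiable at x" and "continuous_on UNIV (iter_partial js \<psi>)"
    and "x \<notin> closure {x. \<psi> x \<noteq> 0} \<Longrightarrow> iter_partial js \<psi> x = 0"
proof -
  show *: "iter_partial js \<psi> differentiable at x" for x
    using assms by (auto simp: test_function_def differentiable_on_def)
  show "continuous_on UNIV (iter_partial js \<psi>)"
    using * differentiable_imp_continuous_within by (fastforce simp: continuous_on_eq_continuous_within)
  show "x \<notin> closure {x. \<psi> x \<noteq> 0} \<Longrightarrow> iter_partial js \<psi> x = 0"
  proof (induction js arbitrary: x)
    case Nil
    then show ?case
      using closure_subset[of "{x. \<psi> x \<noteq> 0}"] by (auto simp: iter_partial_def)
  next
    case (Cons i js)
    have "(iter_partial js \<psi> has_derivative (\<lambda>h. 0)) (at x)"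
      by (rule has_derivative_transform_within_open[where s = "- closure {x. \<psi> x \<noteq> 0}" and f = "\<lambda>x. 0"])
        (use Cons in auto)
    then have "frechet_derivative (iter_partial js \<psi>) (at x) = (\<lambda>h. 0)"
      by (rule frechet_derivative_at[symmetric])
    then show ?case
      by (simp add: iter_partial_def partial_deriv_def)
  qed
qed

lemma integrable_mult_compact_support:
  fixes u v :: "real ^ 'n \<Rightarrow> real"
  assumes "continuous_on UNIV u" "continuous_on UNIV v" "compact K" "\<And>x. x \<notin> K \<Longrightarrow> v x = 0"
  shows "integrable lebesgue (\<lambda>x. u x * v x)"
proof -
  have "integrable lborel (\<lambda>x. indicator K x *\<^sub>R (u x * v x))"
    using assms by (intro borel_integrable_compact continuous_intros continuous_on_subset[OF assms(1)] continuous_on_subset[OF assms(2)]) auto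
  moreover have "(\<lambda>x. indicator K x *\<^sub>R (u x * v x)) = (\<lambda>x. u x * v x)"
  proof
    show "indicator K x *\<^sub>R (u x * v x) = u x * v x" for x
      using assms(4)[of x] by (cases "x \<in> K") auto
  qed
  moreover have "(\<lambda>x. u x * v x) \<in> borel_measurable borel"
    by (intro borel_measurable_continuous_onI continuous_intros assms)
  ultimately show ?thesis
    by (simp add: integrable_completion)
qed

text \<open>Fourier coefficients of an iterated partial derivative.\<close>

definition iter_coeff :: "'n list \<Rightarrow> (real ^ 'n \<Rightarrow> complex) \<Rightarrow> real ^ 'n \<Rightarrow> complex" where
  "iter_coeff js c k = (\<Prod>i\<leftarrow>js. of_real (2 * pi * k $ i) * \<i>) * c k"

text \<open>Each step moves the outermost derivative from the test function to the trigonometric sum, since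
  the product of the two has compact support and its derivative integrates to zero.\<close>

lemma integral_Re_trig_sum_iter_partial:
  assumes "test_function \<psi>"
  shows "(LINT x|lebesgue. Re (trig_sum N c x) * iter_partial js \<psi> x)
     = (- 1) ^ length js * (LINT x|lebesgue. Re (trig_sum N (iter_coeff js c) x) * \<psi> x)"
proof (induction js arbitrary: c)
  case Nil
  then show ?case by (simp add: iter_coeff_def[abs_def] iter_partial_def)
next
  case (Cons i js)
  define v where "v = iter_partial js \<psi>"
  define u where "u x = Re (trig_sum N c x)" for x
  define c' where "c' k = of_real (2 * pi * k $ i) * \<i> * c k" for k
  define u' where "u' x = Re (trig_sum N c' x)" for x
  have v': "iter_partial (i # js) \<psi> = partial_deriv i v"
    by (simp add: v_def iter_partial_def)
  have contu: "continuous_on UNIV u" "continuous_on UNIV u'"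
    unfolding u_def u'_def by (intro continuous_intros)+
  note v = test_function_iter_partial[OF assms, where js = js, folded v_def]
  note v2 = test_function_iter_partial[OF assms, where js = "i # js", unfolded v']
  have du: "u differentiable at x" for x
    unfolding u_def using has_derivative_Re_trig_sum differentiableI by blast
  have pu: "partial_deriv i u = u'"
    by (simp add: u_def[abs_def] u'_def[abs_def] c'_def[abs_def] partial_deriv_Re_trig_sum)
  let ?K = "closure {x. \<psi> x \<noteq> 0}"
  have K: "compact ?K" using assms by (simp add: test_function_def)
  have pd: "partial_deriv i (\<lambda>x. u x * v x) = (\<lambda>x. u x * partial_deriv i v x + u' x * v x)"
    by (simp add: fun_eq_iff partial_deriv_mult[OF du v(1)] pu)
  have "(LINT x|lebesgue. partial_deriv i (\<lambda>x. u x * v x) x) = 0"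
    by (rule integral_partial_deriv_eq_0[OF _ _ K])
      (auto simp: pd intro!: continuous_intros contu v(2) v2(2) v(3) differentiable_mult du v(1))
  then have "(LINT x|lebesgue. u x * partial_deriv i v x) + (LINT x|lebesgue. u' x * v x) = 0"
    unfolding pd using integrable_mult_compact_support[OF contu(1) v2(2) K v2(3)]
      integrable_mult_compact_support[OF contu(2) v(2) K v(3)] by simp
  moreover have "(LINT x|lebesgue. u' x * v x) =
      (- 1) ^ length js * (LINT x|lebesgue. Re (trig_sum N (iter_coeff js c') x) * \<psi> x)"
    unfolding u'_def v_def by (rule Cons.IH)
  moreover have "iter_coeff js c' = iter_coeff (i # js) c"
    by (simp add: iter_coeff_def c'_def fun_eq_iff)
  ultimately show ?case
    by (simp add: u_def v' del: of_real_mult)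
qed

lemma trig_sum_periodic:
  assumes "\<forall>i. k $ i \<in> \<int>"
  shows "trig_sum N c (x + k) = trig_sum N c x"
proof -
  have "character l (x + k) = character l x" if "l \<in> freqs N" for l
  proof -
    have "l \<bullet> k \<in> \<int>"
      using assms that by (auto simp: inner_vec_def freqs_def intro!: Ints_sum Ints_mult)
    then have "cis (2 * pi * (l \<bullet> k)) = 1" by (rule cis_multiple_2pi)
    then show ?thesis by (simp add: character_def inner_add_right distrib_left flip: cis_mult)
  qed
  then show ?thesis by (simp add: trig_sum_def)
qed

lemma Re_trig_sum_in_L2_per: "(\<lambda>x. Re (trig_sum N c x)) \<in> L2_per"
proof -
  have cont: "continuous_on UNIV (\<lambda>x. Re (trig_sum N c x))"
    by (intro continuous_intros)
  have "cell_periodic (\<lambda>x. Re (trig_sum N c x))"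
    by (simp add: cell_periodic_def trig_sum_periodic)
  moreover have "(\<lambda>x. Re (trig_sum N c x)) \<in> borel_measurable lebesgue"
    using borel_measurable_continuous_onI[OF cont] by (simp add: measurable_completion)
  ultimately show ?thesis
    by (auto simp: L2_per_def intro!: integrable_unit_cell continuous_intros)
qed

lemma has_weak_deriv_Re_trig_sum:
  "has_weak_deriv js (\<lambda>x. Re (trig_sum N c x)) (\<lambda>x. Re (trig_sum N (iter_coeff js c) x))"
proof -
  have "locally_integrable (\<lambda>x. Re (trig_sum N c x))" for c :: "real ^ 'a \<Rightarrow> complex"
    unfolding locally_integrable_def set_integrable_def
  proof (intro allI impI)
    fix K :: "(real ^ 'a) set" assume K: "compact K"
    then have [measurable]: "K \<in> sets borel" by (simp add: borel_compact)
    have [measurable]: "(\<lambda>x. Re (trig_sum N c x)) \<in> borel_measurable borel"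
      by (intro borel_measurable_continuous_onI continuous_intros)
    have "integrable lborel (\<lambda>x. indicator K x *\<^sub>R Re (trig_sum N c x))"
      by (intro borel_integrable_compact K continuous_intros)
    then show "integrable lebesgue (\<lambda>x. indicator K x *\<^sub>R Re (trig_sum N c x))"
      by (subst integrable_completion) auto
  qed
  then show ?thesis
    by (simp add: has_weak_deriv_def integral_Re_trig_sum_iter_partial)
qed

lemma Re_trig_sum_in_H_per: "(\<lambda>x. Re (trig_sum N c x)) \<in> H_per m"
  unfolding H_per_def using has_weak_deriv_Re_trig_sum Re_trig_sum_in_L2_per by blast

section \<open>Quadratic forms and second derivatives at a maximum\<close>

text \<open>The discriminant of the nonnegative quadratic polynomial obtained on the line through the two vectors is not positive.\<close>

lemma psd_Cauchy_Schwarz: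
  fixes M :: "real ^ 'n ^ 'n"
  assumes sym: "transpose M = M" and psd: "\<And>x. 0 \<le> (M *v x) \<bullet> x"
  shows "((M *v x) \<bullet> y)\<^sup>2 \<le> ((M *v x) \<bullet> x) * ((M *v y) \<bullet> y)"
proof -
  define a b c where "a = (M *v x) \<bullet> x" and "b = (M *v x) \<bullet> y" and "c = (M *v y) \<bullet> y"
  have b': "(M *v y) \<bullet> x = b"
    using sym by (metis b_def dot_lmul_matrix inner_commute transpose_matrix_vector)
  have quad: "0 \<le> a + 2 * b * t + c * t\<^sup>2" for t
  proof -
    have "(M *v (x + t *\<^sub>R y)) \<bullet> (x + t *\<^sub>R y) = a + 2 * b * t + c * t\<^sup>2"
      by (simp add: matrix_vector_right_distrib inner_add_left inner_add_right b'
          a_def[symmetric] b_def[symmetric] c_def[symmetric] power2_eq_square algebra_simps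
          matrix_vector_mult_scaleR)
    then show ?thesis using psd by metis
  qed
  have c0: "0 \<le> c" using psd by (simp add: c_def)
  show ?thesis unfolding a_def[symmetric] b_def[symmetric] c_def[symmetric]
  proof (cases "c = 0")
    case True
    have "b = 0"
    proof (rule ccontr)
      assume "b \<noteq> 0"
      then show False using quad[of "- (a + 1) / (2 * b)"] True by simp
    qed
    then show "b\<^sup>2 \<le> a * c" using True by simp
  next
    case False
    have "0 \<le> c * (a + 2 * b * (- b / c) + c * (- b / c)\<^sup>2)"
      by (intro mult_nonneg_nonneg c0 quad)
    also have "\<dots> = a * c - b\<^sup>2"
      using False by (simp add: power2_eq_square field_simps)
    finally show "b\<^sup>2 \<le> a * c" by simp
  qed
qed

lemma matrix_entry_eq_inner: "M $ i $ j = (M *v axis j 1) \<bullet> axis i (1::real)"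
  by (simp add: matrix_vector_mult_basis column_def inner_axis)

text \<open>The \<open>2 \<times> 2\<close> minors of \<open>- H\<close> are nonnegative, that is \<open>H\<^sub>i\<^sub>j\<^sup>2 \<le> H\<^sub>i\<^sub>i H\<^sub>j\<^sub>j\<close>; summing over
  \<open>i\<close> and \<open>j\<close> gives the square of the trace.\<close>

lemma norm_le_minus_trace:
  fixes H :: "real ^ 'n ^ 'n"
  assumes sym: "transpose H = H" and nsd: "\<And>x. (H *v x) \<bullet> x \<le> 0"
  shows "norm H \<le> - trace H"
proof -
  have neg: "(- H) *v x = - (H *v x)" for x
    by (simp add: matrix_vector_mult_def vec_eq_iff sum_negf)
  have "transpose (- H) = - transpose H" by (simp add: transpose_def vec_eq_iff)
  then have psd: "transpose (- H) = - H" "\<And>x. 0 \<le> ((- H) *v x) \<bullet> x"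
    using sym nsd by (auto simp: neg)
  have entry: "(H $ i $ j)\<^sup>2 \<le> H $ i $ i * H $ j $ j" for i j
    using psd_Cauchy_Schwarz[OF psd, of "axis j 1" "axis i 1"]
    by (simp add: neg matrix_entry_eq_inner[symmetric] mult.commute)
  have "H \<bullet> H \<le> (\<Sum>i\<in>UNIV. \<Sum>j\<in>UNIV. H $ i $ i * H $ j $ j)"
    unfolding matrix_inner_eq using entry by (intro sum_mono) (simp add: power2_eq_square)
  also have "\<dots> = (- trace H)\<^sup>2"
    by (simp add: trace_def power2_eq_square sum_product)
  finally have "H \<bullet> H \<le> (- trace H)\<^sup>2" .
  moreover have "0 \<le> - trace H"
    unfolding trace_def using nsd[of "axis _ 1"]
    by (simp add: matrix_entry_eq_inner[symmetric] sum_nonpos)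
  ultimately show ?thesis
    unfolding matrix_norm_eq by (rule real_le_lsqrt[rotated])
qed

lemma inner_mat_1: "M \<bullet> mat 1 = trace M" for M :: "real ^ 'n ^ 'n"
  by (simp add: matrix_inner_eq trace_def mat_def if_distrib cong: if_cong)

text \<open>Splitting off the identity from \<open>B\<close> leaves \<open>tr H\<close> plus a term of size at most \<open>\<bar>H\<bar> \<le> - tr H\<close>.
  Approximations of a symmetric \<open>B\<close> need not be symmetric, so the argument rests on the distance to the
  identity alone.\<close>

lemma near_identity_inner_nonpos:
  fixes B H :: "real ^ 'n ^ 'n"
  assumes "norm (B - mat 1) \<le> 1" "transpose H = H" "\<And>x. (H *v x) \<bullet> x \<le> 0"
  shows "B \<bullet> H \<le> 0"
proof -
  have "B \<bullet> H = (B - mat 1) \<bullet> H + trace H"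
    by (simp add: inner_diff_left inner_commute[of "mat 1"] inner_mat_1)
  moreover have "(B - mat 1) \<bullet> H \<le> norm (B - mat 1) * norm H"
    by (rule norm_cauchy_schwarz)
  moreover have "\<dots> \<le> 1 * norm H"
    using assms(1) by (intro mult_right_mono) auto
  ultimately show ?thesis
    using norm_le_minus_trace[OF assms(2,3)] by simp
qed

text \<open>A positive second derivative would make the function increase to the right of the critical point.\<close>

lemma second_derivative_at_max:
  fixes g g' :: "real \<Rightarrow> real"
  assumes g: "\<And>t. (g has_real_derivative g' t) (at t)" and g': "(g' has_real_derivative d) (at 0)"
    and max: "\<And>t. g t \<le> g 0"
  shows "d \<le> 0"
proof (rule ccontr)
  assume "\<not> d \<le> 0"
  then obtain e where e: "0 < e" "\<And>h. 0 < h \<Longrightarrow> h < e \<Longrightarrow> g' 0 < g' (0 + h)"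
    using DERIV_pos_inc_right[OF g'] by auto
  have "g' 0 = 0"
    by (rule DERIV_local_max[OF g zero_less_one]) (simp add: max)
  obtain t where "0 < t" "t < e / 2" "g (e / 2) - g 0 = (e / 2 - 0) * g' t"
    using MVT2[of 0 "e / 2" g g'] g e(1) by auto
  moreover from this have "0 < e / 2 * g' t"
    using e(2)[of t] \<open>g' 0 = 0\<close> e(1) by simp
  ultimately show False using max[of "e / 2"] by simp
qed

section \<open>Potentials and the maximum principle\<close>

text \<open>The real part of \<open>\<phi> = \<Delta>\<^sup>-\<^sup>1 u\<close>, where \<open>u\<close> has coefficients \<open>f\<close>. Taking real parts is harmless since the
  equations for \<open>\<phi>\<close> have real coefficients.\<close>

definition potential :: "nat \<Rightarrow> (real ^ 'n \<Rightarrow> complex) \<Rightarrow> real ^ 'n \<Rightarrow> real" where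
  "potential N f x = Re (trig_sum N (\<lambda>k. - f k / of_real (4 * pi\<^sup>2 * (k \<bullet> k))) x)"

definition potential_hessian :: "nat \<Rightarrow> (real ^ 'n \<Rightarrow> complex) \<Rightarrow> real ^ 'n \<Rightarrow> real ^ 'n ^ 'n" where
  "potential_hessian N f x = (\<chi> i j. Re (hessian_sum N f i j x))"

lemma iter_coeff_potential:
  "iter_coeff [i, j] (\<lambda>k. - f k / of_real (4 * pi\<^sup>2 * (k \<bullet> k))) = (\<lambda>k. of_real (k $ i * k $ j / (k \<bullet> k)) * f k)"
proof
  fix k :: "real ^ 'a"
  show "iter_coeff [i, j] (\<lambda>k. - f k / of_real (4 * pi\<^sup>2 * (k \<bullet> k))) k = of_real (k $ i * k $ j / (k \<bullet> k)) * f k"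
    by (cases "k = 0") (simp_all add: iter_coeff_def field_simps power2_eq_square)
qed

lemma has_weak_hessian_potential: "has_weak_hessian (potential N f) (potential_hessian N f)"
  unfolding has_weak_hessian_def
proof (intro allI)
  fix i j
  show "has_weak_deriv [i, j] (potential N f) (\<lambda>x. potential_hessian N f x $ i $ j)"
    using has_weak_deriv_Re_trig_sum[of "[i, j]" N "\<lambda>k. - f k / of_real (4 * pi\<^sup>2 * (k \<bullet> k))", unfolded iter_coeff_potential]
    unfolding potential_def[abs_def] potential_hessian_def hessian_sum_def by simp
qed

lemma potential_in_H_per: "potential N f \<in> H_per m"
  unfolding potential_def[abs_def] by (rule Re_trig_sum_in_H_per)

lemma continuous_on_potential_hessian: "continuous_on S (potential_hessian N f)"
  unfolding potential_hessian_def hessian_sum_def by (intro continuous_intros)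

lemma integral_norm_potential_hessian:
  assumes "f 0 = 0"
  shows "(LINT x|lebesgue_on unit_cell. (norm (potential_hessian N f x))\<^sup>2) \<le> (coeff_norm N f)\<^sup>2"
proof -
  have "(norm (potential_hessian N f x))\<^sup>2 \<le> (\<Sum>i\<in>UNIV. \<Sum>j\<in>UNIV. (cmod (hessian_sum N f i j x))\<^sup>2)" for x
  proof -
    have "(Re z)\<^sup>2 \<le> (cmod z)\<^sup>2" for z
      using abs_Re_le_cmod[of z] by (intro power2_le_iff_abs_le[THEN iffD2]) auto
    then show ?thesis
      unfolding power2_norm_eq_inner matrix_inner_eq potential_hessian_def
      by (intro sum_mono) (simp add: power2_eq_square)
  qed
  then have "(LINT x|lebesgue_on unit_cell. (norm (potential_hessian N f x))\<^sup>2)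
     \<le> (LINT x|lebesgue_on unit_cell. (\<Sum>i\<in>UNIV. \<Sum>j\<in>UNIV. (cmod (hessian_sum N f i j x))\<^sup>2))"
    by (intro integral_mono integrable_unit_cell continuous_intros continuous_on_potential_hessian)
       (simp_all add: hessian_sum_def continuous_intros)
  then show ?thesis by (simp add: integral_norm_hessian_sum[where f = f, OF assms])
qed

lemma Re_trig_sum_attains_max:
  obtains x0 where "\<And>x. Re (trig_sum N c x) \<le> Re (trig_sum N c x0)"
proof -
  have "continuous_on (cbox 0 (1 :: real ^ 'a)) (\<lambda>x. Re (trig_sum N c x))"
    by (intro continuous_intros)
  moreover have "(0 :: real ^ 'a) \<in> cbox 0 1" by (simp add: mem_box_cart)
  ultimately obtain x0 :: "real ^ 'a" where x0: "\<And>x. x \<in> cbox 0 1 \<Longrightarrow> Re (trig_sum N c x) \<le> Re (trig_sum N c x0)"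
    using continuous_attains_sup[of "cbox 0 (1 :: real ^ 'a)" "\<lambda>x. Re (trig_sum N c x)"] by auto
  have "Re (trig_sum N c x) \<le> Re (trig_sum N c x0)" for x
  proof -
    define k :: "real ^ 'a" where "k = (\<chi> i. - of_int \<lfloor>x $ i\<rfloor>)"
    have "x + k \<in> cbox 0 1" unfolding mem_box_cart k_def by (auto) linarith+
    moreover have "trig_sum N c (x + k) = trig_sum N c x"
      by (rule trig_sum_periodic) (simp add: k_def)
    ultimately show ?thesis using x0[of "x + k"] by simp
  qed
  then show ?thesis by (rule that)
qed

lemma has_real_derivative_trig_sum_line:
  "((\<lambda>t. Re (trig_sum N c (x + t *\<^sub>R v))) has_real_derivative
     Re (trig_sum N (\<lambda>k. of_real (2 * pi * (k \<bullet> v)) * \<i> * c k) (x + t *\<^sub>R v))) (at t)"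
proof -
  have "((\<lambda>x. Re (trig_sum N c x)) \<circ> (\<lambda>t. x + t *\<^sub>R v) has_derivative
      (\<lambda>h. Re (trig_sum N (\<lambda>k. of_real (2 * pi * (k \<bullet> h)) * \<i> * c k) (x + t *\<^sub>R v))) \<circ> (\<lambda>h. h *\<^sub>R v)) (at t)"
    by (intro diff_chain_at has_derivative_Re_trig_sum) (auto intro!: derivative_eq_intros)
  moreover have "Re (trig_sum N (\<lambda>k. of_real (2 * pi * (k \<bullet> h *\<^sub>R v)) * \<i> * c k) y)
     = h * Re (trig_sum N (\<lambda>k. of_real (2 * pi * (k \<bullet> v)) * \<i> * c k) y)" for h y
  proof -
    have "trig_sum N (\<lambda>k. of_real (2 * pi * (k \<bullet> h *\<^sub>R v)) * \<i> * c k) y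
       = of_real h * trig_sum N (\<lambda>k. of_real (2 * pi * (k \<bullet> v)) * \<i> * c k) y"
      by (simp add: trig_sum_def sum_distrib_left mult_ac)
    then show ?thesis by simp
  qed
  ultimately show ?thesis
    unfolding has_field_derivative_def o_def
    by (elim has_derivative_eq_rhs) (simp add: fun_eq_iff)
qed

lemma transpose_potential_hessian: "transpose (potential_hessian N f x) = potential_hessian N f x"
  by (simp add: transpose_def potential_hessian_def vec_eq_iff hessian_sum_def mult.commute)

lemma potential_hessian_quadratic_form:
  "(potential_hessian N f x *v v) \<bullet> v = Re (trig_sum N (\<lambda>k. of_real ((k \<bullet> v)\<^sup>2 / (k \<bullet> k)) * f k) x)"
proof -
  have "(\<Sum>i\<in>UNIV. \<Sum>j\<in>UNIV. of_real (v $ i * v $ j) * hessian_sum N f i j x)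
      = (\<Sum>i\<in>UNIV. \<Sum>j\<in>UNIV. \<Sum>k\<in>freqs N. of_real (v $ i * v $ j) * (of_real (k $ i * k $ j / (k \<bullet> k)) * f k * character k x))"
    by (simp add: hessian_sum_def trig_sum_def sum_distrib_left)
  also have "\<dots> = (\<Sum>k\<in>freqs N. \<Sum>i\<in>UNIV. \<Sum>j\<in>UNIV. of_real (v $ i * v $ j) * (of_real (k $ i * k $ j / (k \<bullet> k)) * f k * character k x))"
  proof -
    have "(\<Sum>j\<in>UNIV. \<Sum>k\<in>freqs N. h i j k) = (\<Sum>k\<in>freqs N. \<Sum>j\<in>UNIV. h i j k)" for h :: "'a \<Rightarrow> 'a \<Rightarrow> real ^ 'a \<Rightarrow> complex" and i
      by (rule sum.swap)
    moreover have "(\<Sum>i\<in>UNIV. \<Sum>k\<in>freqs N. h i k) = (\<Sum>k\<in>freqs N. \<Sum>i\<in>UNIV. h i k)" for h :: "'a \<Rightarrow> real ^ 'a \<Rightarrow> complex"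
      by (rule sum.swap)
    ultimately show ?thesis by simp
  qed
  also have "\<dots> = trig_sum N (\<lambda>k. of_real ((k \<bullet> v)\<^sup>2 / (k \<bullet> k)) * f k) x"
    unfolding trig_sum_def
  proof (rule sum.cong[OF refl])
    fix k :: "real ^ 'a"
    have "(k \<bullet> v)\<^sup>2 = (\<Sum>i\<in>UNIV. \<Sum>j\<in>UNIV. v $ i * v $ j * (k $ i * k $ j))"
      by (simp add: inner_vec_def power2_eq_square sum_product mult_ac)
    then have "of_real ((k \<bullet> v)\<^sup>2 / (k \<bullet> k)) = (\<Sum>i\<in>UNIV. \<Sum>j\<in>UNIV. complex_of_real (v $ i * v $ j) * of_real (k $ i * k $ j / (k \<bullet> k)))"
      by (simp add: sum_divide_distrib)
    then show "(\<Sum>i\<in>UNIV. \<Sum>j\<in>UNIV. of_real (v $ i * v $ j) * (of_real (k $ i * k $ j / (k \<bullet> k)) * f k * character k x))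
       = of_real ((k \<bullet> v)\<^sup>2 / (k \<bullet> k)) * f k * character k x"
      by (simp only: sum_distrib_right mult.assoc)
  qed
  finally have "Re (\<Sum>i\<in>UNIV. \<Sum>j\<in>UNIV. of_real (v $ i * v $ j) * hessian_sum N f i j x)
     = Re (trig_sum N (\<lambda>k. of_real ((k \<bullet> v)\<^sup>2 / (k \<bullet> k)) * f k) x)" by simp
  moreover have "Re (\<Sum>i\<in>UNIV. \<Sum>j\<in>UNIV. of_real (v $ i * v $ j) * hessian_sum N f i j x)
      = (potential_hessian N f x *v v) \<bullet> v"
    by (simp add: inner_vec_def matrix_vector_mult_def potential_hessian_def sum_distrib_left sum_distrib_right mult_ac del: of_real_mult)
  ultimately show ?thesis by simp
qed

text \<open>The quadratic form of the Hessian at a vector is the second derivative of the potential along the line in this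
  direction, so any global maximum point, which exists by periodicity, will do.\<close>

lemma maximum_principle:
  obtains x0 where "\<And>v. (potential_hessian N f x0 *v v) \<bullet> v \<le> 0"
proof -
  define c where "c k = - f k / of_real (4 * pi\<^sup>2 * (k \<bullet> k))" for k :: "real ^ 'a"
  obtain x0 :: "real ^ 'a" where x0: "\<And>x. Re (trig_sum N c x) \<le> Re (trig_sum N c x0)"
    using Re_trig_sum_attains_max[of N c] by metis
  have "(potential_hessian N f x0 *v v) \<bullet> v \<le> 0" for v
  proof -
    define c' where "c' k = of_real (2 * pi * (k \<bullet> v)) * \<i> * c k" for k :: "real ^ 'a"
    have g: "((\<lambda>t. Re (trig_sum N c (x0 + t *\<^sub>R v))) has_real_derivative Re (trig_sum N c' (x0 + t *\<^sub>R v))) (at t)" for t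
      using has_real_derivative_trig_sum_line[of N c x0 v t] unfolding c'_def .
    have "of_real (2 * pi * (k \<bullet> v)) * \<i> * c' k = of_real ((k \<bullet> v)\<^sup>2 / (k \<bullet> k)) * f k" for k
      by (cases "k = 0") (simp_all add: c'_def c_def field_simps power2_eq_square)
    then have "((\<lambda>t. Re (trig_sum N c' (x0 + t *\<^sub>R v))) has_real_derivative (potential_hessian N f x0 *v v) \<bullet> v) (at 0)"
      using has_real_derivative_trig_sum_line[of N c' x0 v 0]
      by (simp add: potential_hessian_quadratic_form del: of_real_mult of_real_divide)
    from second_derivative_at_max[OF g this] show ?thesis by (simp add: x0)
  qed
  then show ?thesis by (rule that)
qed

section \<open>Approximation by trigonometric polynomials\<close>

text \<open>Polynomials on the ambient space restrict to trigonometric polynomials along this map, which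
  makes the Stone-Weierstrass theorem and extension theorems for Euclidean spaces applicable to periodic approximation.\<close>

definition torus_embedding :: "real ^ 'n \<Rightarrow> (real ^ 'n) \<times> (real ^ 'n)" where
  "torus_embedding x = ((\<chi> i. cos (2 * pi * x $ i)), (\<chi> i. sin (2 * pi * x $ i)))"

lemma trig_poly_cos_sin:
  shows "trig_poly 1 (\<lambda>x. of_real (cos (2 * pi * x $ i)))"
    and "trig_poly 1 (\<lambda>x. of_real (sin (2 * pi * x $ i)))"
proof -
  have ax: "axis i 1 \<in> freqs 1" "- axis i 1 \<in> freqs 1"
    by (auto simp: freqs_def axis_def)
  have ch: "character (axis i 1) x = cis (2 * pi * x $ i)" "character (- axis i 1) x = cis (- (2 * pi * x $ i))" for x
    by (simp_all add: character_def inner_axis inner_commute[of "axis i 1"])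
  have "trig_poly 1 (\<lambda>x. (1/2) * character (axis i 1) x + (1/2) * character (- axis i 1) x)"
    by (intro trig_poly_add trig_poly_character ax)
  moreover have "(\<lambda>x. (1/2) * character (axis i 1) x + (1/2) * character (- axis i 1) x) = (\<lambda>x. of_real (cos (2 * pi * x $ i)))"
    by (simp add: ch fun_eq_iff complex_eq_iff)
  ultimately show "trig_poly 1 (\<lambda>x. of_real (cos (2 * pi * x $ i)))" by simp
  have "trig_poly 1 (\<lambda>x. (-\<i>/2) * character (axis i 1) x + (\<i>/2) * character (- axis i 1) x)"
    by (intro trig_poly_add trig_poly_character ax)
  moreover have "(\<lambda>x. (-\<i>/2) * character (axis i 1) x + (\<i>/2) * character (- axis i 1) x) = (\<lambda>x. of_real (sin (2 * pi * x $ i)))"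
    by (simp add: ch fun_eq_iff complex_eq_iff)
  ultimately show "trig_poly 1 (\<lambda>x. of_real (sin (2 * pi * x $ i)))" by simp
qed

lemma trig_poly_polynomial_torus:
  fixes p :: "(real ^ 'n) \<times> (real ^ 'n) \<Rightarrow> real"
  assumes "real_polynomial_function p"
  shows "\<exists>M. trig_poly M (\<lambda>x. of_real (p (torus_embedding x)))"
  using assms
proof induction
  case (linear f)
  then interpret bounded_linear f .
  have "torus_embedding x = (\<Sum>i\<in>UNIV. cos (2 * pi * x $ i) *\<^sub>R (axis i 1, 0)) + (\<Sum>i\<in>UNIV. sin (2 * pi * x $ i) *\<^sub>R (0, axis i 1))" for x :: "real ^ 'n"
    by (simp add: torus_embedding_def prod_eq_iff fst_sum snd_sum vec_eq_iff axis_def if_distrib cong: if_cong)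
  then have eq: "complex_of_real (f (torus_embedding x)) = (\<Sum>i\<in>UNIV. of_real (cos (2 * pi * x $ i)) * of_real (f (axis i 1, 0)))
      + (\<Sum>i\<in>UNIV. of_real (sin (2 * pi * x $ i)) * of_real (f (0, axis i 1)))" for x :: "real ^ 'n"
    by (simp add: add sum scaleR del: scaleR_Pair)
  have "trig_poly (1 + 0) (\<lambda>x. complex_of_real (f (torus_embedding x)))"
    unfolding eq by (intro trig_poly_add trig_poly_sum trig_poly_mult trig_poly_cos_sin trig_poly_const) auto
  then show ?case by blast
next
  case (const c)
  show ?case using trig_poly_const by blast
next
  case (add f g)
  then obtain M N where "trig_poly M (\<lambda>x. complex_of_real (f (torus_embedding x)))"
      "trig_poly N (\<lambda>x. complex_of_real (g (torus_embedding x)))" by blast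
  then have "trig_poly (max M N) (\<lambda>x. of_real (f (torus_embedding x)) + of_real (g (torus_embedding x)))"
    by (intro trig_poly_add) (auto elim: trig_poly_mono)
  then show ?case by auto
next
  case (mult f g)
  then show ?case by (auto dest: trig_poly_mult)
qed

lemma continuous_on_torus_embedding: "continuous_on S torus_embedding"
  unfolding torus_embedding_def by (intro continuous_intros)

lemma inj_on_torus_embedding: "inj_on torus_embedding unit_cell"
proof (rule inj_onI)
  fix x y :: "real ^ 'n" assume xy: "x \<in> unit_cell" "y \<in> unit_cell" and eq: "torus_embedding x = torus_embedding y"
  have "x $ i = y $ i" for i
  proof -
    have "sin (2 * pi * x $ i) = sin (2 * pi * y $ i) \<and> cos (2 * pi * x $ i) = cos (2 * pi * y $ i)"
      using eq by (simp add: torus_embedding_def vec_eq_iff)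
    then obtain n :: int where "2 * pi * x $ i = 2 * pi * y $ i + 2 * pi * n"
      unfolding sin_cos_eq_iff by blast
    then have "2 * pi * (x $ i) = 2 * pi * (y $ i + n)" by (simp add: algebra_simps)
    then have "x $ i = y $ i + n" by simp
    moreover have "0 < x $ i" "x $ i < 1" "0 < y $ i" "y $ i < 1"
      using xy by (auto simp: unit_cell_eq)
    ultimately have "- 1 < real_of_int n" "real_of_int n < 1" by linarith+
    then have "n = 0" by linarith
    then show ?thesis using \<open>x $ i = y $ i + n\<close> by simp
  qed
  then show "x = y" by (simp add: vec_eq_iff)
qed

lemma norm_torus_embedding_le: "norm (torus_embedding (x :: real ^ 'n)) \<le> 2 * real CARD('n)"
proof -
  have "norm (torus_embedding x) \<le> norm (\<chi> i. cos (2 * pi * x $ i)) + norm (\<chi> i. sin (2 * pi * x $ i))"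
    unfolding torus_embedding_def by (rule norm_Pair_le)
  also have "\<dots> \<le> (\<Sum>i\<in>UNIV. \<bar>cos (2 * pi * x $ i)\<bar>) + (\<Sum>i\<in>UNIV. \<bar>sin (2 * pi * x $ i)\<bar>)"
    by (rule add_mono; rule order_trans[OF norm_le_l1_cart]) simp_all
  also have "\<dots> \<le> (\<Sum>i\<in>(UNIV :: 'n set). 1) + (\<Sum>i\<in>(UNIV :: 'n set). 1)"
    by (intro add_mono sum_mono) (auto simp: abs_cos_le_one abs_sin_le_one)
  finally show ?thesis by simp
qed

text \<open>A measurable function is almost everywhere a limit of continuous ones, and projecting these to
  \<open>C\<close> keeps the limit. On a compact cube inside the open cell the torus embedding is a homeomorphism onto its
  image, so the continuous function can be transported there, extended with values in the convex set
  \<open>C\<close> by Dugundji's theorem, and approximated by a polynomial on a ball containing the torus.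
  The cubes exhaust the cell.\<close>

lemma trig_poly_approximation:
  fixes F :: "real ^ 'n \<Rightarrow> 'b :: euclidean_space" and \<epsilon> :: "nat \<Rightarrow> real"
  assumes F: "F \<in> borel_measurable lebesgue" and C: "convex C" "closed C" "C \<noteq> {}"
    and FC: "AE x in lebesgue. x \<in> unit_cell \<longrightarrow> F x \<in> C"
    and \<epsilon>: "\<And>m. 0 < \<epsilon> m" "\<epsilon> \<longlonglongrightarrow> 0"
  obtains P where "\<And>m b. \<exists>M. trig_poly M (\<lambda>x. of_real (P m x \<bullet> b))"
    "\<And>m x. \<exists>y\<in>C. dist (P m x) y < \<epsilon> m"
    "AE x in lebesgue. x \<in> unit_cell \<longrightarrow> (\<lambda>m. P m x) \<longlonglongrightarrow> F x"
proof -
  have "F measurable_on UNIV"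
    using F by (intro lebesgue_measurable_imp_measurable_on) auto
  then obtain Z g where Z: "negligible Z" and g: "\<And>m. continuous_on UNIV (g m)"
    and lim: "\<And>x. x \<notin> Z \<Longrightarrow> (\<lambda>m. g m x) \<longlonglongrightarrow> F x"
    unfolding measurable_on_def by auto
  define Q :: "nat \<Rightarrow> (real ^ 'n) set" where
    "Q m = cbox (\<chi> i. 1 / real (Suc m)) (\<chi> i. 1 - 1 / real (Suc m))" for m
  have Qcell: "Q m \<subseteq> unit_cell" for m
  proof
    fix x assume "x \<in> Q m"
    then have "1 / real (Suc m) \<le> x $ i \<and> x $ i \<le> 1 - 1 / real (Suc m)" for i
      by (auto simp: Q_def mem_box_cart)
    moreover have "0 < 1 / real (Suc m)" by simp
    ultimately have "0 < x $ i \<and> x $ i < 1" for i by (meson less_le_trans le_less_trans diff_less_eq less_add_same_cancel1)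
    then show "x \<in> unit_cell" by (simp add: unit_cell_eq)
  qed
  have cpc: "continuous_on UNIV (closest_point C)"
    using C continuous_on_closest_point by blast
  have "\<exists>h. continuous_on UNIV h \<and> range h \<subseteq> C \<and> (\<forall>x\<in>Q m. h (torus_embedding x) = closest_point C (g m x))" for m
  proof -
    have "compact (Q m)" by (simp add: Q_def)
    moreover have "inj_on torus_embedding (Q m)"
      using inj_on_subset[OF inj_on_torus_embedding Qcell] .
    ultimately obtain G where G: "homeomorphism (Q m) (torus_embedding ` Q m) torus_embedding G"
      using homeomorphism_compact[OF _ continuous_on_torus_embedding refl] by blast
    have cl: "closedin (top_of_set UNIV) (torus_embedding ` Q m)"
      by (simp add: compact_imp_closed compact_continuous_image continuous_on_torus_embedding Q_def)
    have cont: "continuous_on (torus_embedding ` Q m) (\<lambda>y. closest_point C (g m (G y)))"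
      by (rule continuous_on_compose2[OF cpc continuous_on_compose2[OF g]])
        (use G in \<open>auto simp: homeomorphism_def\<close>)
    have "(\<lambda>y. closest_point C (g m (G y))) ` torus_embedding ` Q m \<subseteq> C"
      using closest_point_in_set[OF C(2,3)] by auto
    from Dugundji[OF C(1,3) cl cont this]
    obtain h where h: "continuous_on UNIV h" "range h \<subseteq> C"
      "\<And>y. y \<in> torus_embedding ` Q m \<Longrightarrow> h y = closest_point C (g m (G y))" by blast
    moreover have "G (torus_embedding x) = x" if "x \<in> Q m" for x
      using G that by (simp add: homeomorphism_def)
    ultimately show ?thesis by (intro exI[of _ h]) auto
  qed
  then obtain h where h: "\<And>m. continuous_on UNIV (h m)" "\<And>m. range (h m) \<subseteq> C"
    and hQ: "\<And>m x. x \<in> Q m \<Longrightarrow> h m (torus_embedding x) = closest_point C (g m x)"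
    by metis
  let ?K = "cball (0 :: (real ^ 'n) \<times> (real ^ 'n)) (2 * real CARD('n))"
  have "\<exists>p. polynomial_function p \<and> (\<forall>y\<in>?K. norm (h m y - p y) < \<epsilon> m)" for m
    by (rule Stone_Weierstrass_polynomial_function) (auto intro: continuous_on_subset[OF h(1)] \<epsilon>)
  then obtain p where p: "\<And>m. polynomial_function (p m)" "\<And>m y. y \<in> ?K \<Longrightarrow> norm (h m y - p m y) < \<epsilon> m"
    by metis
  define P where "P m x = p m (torus_embedding x)" for m and x :: "real ^ 'n"
  have close: "dist (P m x) (h m (torus_embedding x)) < \<epsilon> m" for m x
    using p(2)[of "torus_embedding x" m] norm_torus_embedding_le[of x] by (simp add: P_def dist_norm norm_minus_commute)
  show ?thesis
  proof (rule that[of P])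
    show "\<exists>M. trig_poly M (\<lambda>x. of_real (P m x \<bullet> b))" for m b
    proof -
      have "real_polynomial_function (\<lambda>y. p m y \<bullet> b)"
        using p(1)[of m] bounded_linear_inner_left[of b] unfolding polynomial_function_def o_def by blast
      then show ?thesis unfolding P_def by (rule trig_poly_polynomial_torus)
    qed
    show "\<exists>y\<in>C. dist (P m x) y < \<epsilon> m" for m x
      using close h(2) by blast
    have "AE x in lebesgue. x \<notin> Z"
      using Z by (auto simp: negligible_iff_null_sets intro: AE_not_in)
    with FC show "AE x in lebesgue. x \<in> unit_cell \<longrightarrow> (\<lambda>m. P m x) \<longlonglongrightarrow> F x"
    proof eventually_elim
      case (elim x)
      show ?case
      proof
        assume x: "x \<in> unit_cell"
        have "(\<lambda>m. closest_point C (g m x)) \<longlonglongrightarrow> closest_point C (F x)"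
          using continuous_on_tendsto_compose[OF cpc lim[OF elim(2)]] by simp
        then have *: "(\<lambda>m. closest_point C (g m x)) \<longlonglongrightarrow> F x"
          using x elim(1) by (simp add: closest_point_self)
        have "\<forall>\<^sub>F m in sequentially. x \<in> Q m"
        proof -
          have l: "(\<lambda>m. 1 / real (Suc m)) \<longlonglongrightarrow> 0"
            using LIMSEQ_Suc[OF lim_1_over_n] by simp
          have "\<forall>\<^sub>F m in sequentially. \<forall>i\<in>UNIV. 1 / real (Suc m) < min (x $ i) (1 - x $ i)"
          proof (rule eventually_ball_finite[OF finite], rule ballI)
            show "\<forall>\<^sub>F m in sequentially. 1 / real (Suc m) < min (x $ i) (1 - x $ i)" for i
              by (rule order_tendstoD(2)[OF l]) (use x in \<open>auto simp: unit_cell_eq\<close>)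
          qed
          then show ?thesis
            by eventually_elim (auto simp: Q_def mem_box_cart less_imp_le, smt (verit))
        qed
        then have "\<forall>\<^sub>F m in sequentially. closest_point C (g m x) = h m (torus_embedding x)"
          by eventually_elim (simp add: hQ)
        with * have "(\<lambda>m. h m (torus_embedding x)) \<longlonglongrightarrow> F x"
          by (rule Lim_transform_eventually)
        moreover have "(\<lambda>m. P m x - h m (torus_embedding x)) \<longlonglongrightarrow> 0"
          by (rule Lim_null_comparison[OF _ \<epsilon>(2)]) (use close in \<open>auto simp: dist_norm less_imp_le\<close>)
        ultimately show "(\<lambda>m. P m x) \<longlonglongrightarrow> F x"
          using tendsto_add by fastforce
      qed
    qed
  qed
qed

section \<open>The sign of a density orthogonal to the range\<close>

lemma unit_cell_lmeasurable: "unit_cell \<in> lmeasurable"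
  by (simp add: unit_cell_def)

lemma measure_unit_cell [simp]: "measure (lebesgue_on unit_cell) (unit_cell :: (real ^ 'n) set) = 1"
proof -
  have "(LINT x|lebesgue_on (unit_cell :: (real ^ 'n) set). (1 :: complex)) = 1"
    using integral_character[of "0 :: real ^ 'n"] by simp
  then show ?thesis by (simp add: scaleR_conv_of_real)
qed

lemma AE_unit_cell_iff:
  "(AE x in lebesgue_on unit_cell. P x) \<longleftrightarrow> (AE x in lebesgue. x \<in> unit_cell \<longrightarrow> P x)"
  by (rule AE_restrict_space_iff) (simp add: unit_cell_borel)

text \<open>The discriminant argument for \<open>\<integral> (t \<bar>u\<bar> - \<bar>v\<bar>)\<^sup>2 \<ge> 0\<close>.\<close>

lemma Cauchy_Schwarz_integral:
  fixes u v :: "'a \<Rightarrow> real"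
  assumes [measurable]: "u \<in> borel_measurable M" "v \<in> borel_measurable M"
    and u: "integrable M (\<lambda>x. (u x)\<^sup>2)" and v: "integrable M (\<lambda>x. (v x)\<^sup>2)"
  shows "integrable M (\<lambda>x. u x * v x)"
    and "(LINT x|M. \<bar>u x * v x\<bar>) \<le> sqrt (LINT x|M. (u x)\<^sup>2) * sqrt (LINT x|M. (v x)\<^sup>2)"
proof -
  show int: "integrable M (\<lambda>x. u x * v x)"
  proof (rule Bochner_Integration.integrable_bound[OF Bochner_Integration.integrable_add[OF u v]])
    have "\<bar>a * b\<bar> \<le> a\<^sup>2 + b\<^sup>2" for a b :: real
    proof -
      have "2 * (\<bar>a\<bar> * \<bar>b\<bar>) \<le> a\<^sup>2 + b\<^sup>2" "0 \<le> \<bar>a\<bar> * \<bar>b\<bar>"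
        using sum_squares_bound[of "\<bar>a\<bar>" "\<bar>b\<bar>"] by simp_all
      then show ?thesis unfolding abs_mult by linarith
    qed
    then show "AE x in M. norm (u x * v x) \<le> norm ((u x)\<^sup>2 + (v x)\<^sup>2)"
      by (auto intro!: AE_I2)
  qed simp
  define a b c where "a = (LINT x|M. (u x)\<^sup>2)" and "b = (LINT x|M. (v x)\<^sup>2)" and "c = (LINT x|M. \<bar>u x * v x\<bar>)"
  have quad: "0 \<le> a * t\<^sup>2 - 2 * t * c + b" for t
  proof -
    have "0 \<le> (LINT x|M. (t * \<bar>u x\<bar> - \<bar>v x\<bar>)\<^sup>2)" by simp
    also have "(\<lambda>x. (t * \<bar>u x\<bar> - \<bar>v x\<bar>)\<^sup>2) = (\<lambda>x. t\<^sup>2 * (u x)\<^sup>2 - 2 * t * \<bar>u x * v x\<bar> + (v x)\<^sup>2)"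
      by (simp add: power2_diff power_mult_distrib abs_mult algebra_simps)
    also have "(LINT x|M. t\<^sup>2 * (u x)\<^sup>2 - 2 * t * \<bar>u x * v x\<bar> + (v x)\<^sup>2) = a * t\<^sup>2 - 2 * t * c + b"
      using u v int by (simp add: a_def b_def c_def)
    finally show ?thesis .
  qed
  have nn: "0 \<le> a" "0 \<le> b" "0 \<le> c" by (simp_all add: a_def b_def c_def)
  have "c\<^sup>2 \<le> a * b"
  proof (cases "a = 0")
    case True
    have "c = 0"
    proof (rule ccontr)
      assume "c \<noteq> 0"
      then show False using quad[of "(b + 1) / (2 * c)"] True by simp
    qed
    then show ?thesis using nn by simp
  next
    case False
    have "0 \<le> a * (a * (c / a)\<^sup>2 - 2 * (c / a) * c + b)"
      by (intro mult_nonneg_nonneg nn quad)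
    also have "\<dots> = a * b - c\<^sup>2"
      using False by (simp add: power2_eq_square field_simps)
    finally show ?thesis by simp
  qed
  then have "c \<le> sqrt (a * b)" using nn by (intro real_le_rsqrt)
  then show "(LINT x|M. \<bar>u x * v x\<bar>) \<le> sqrt (LINT x|M. (u x)\<^sup>2) * sqrt (LINT x|M. (v x)\<^sup>2)"
    by (simp add: real_sqrt_mult a_def b_def c_def)
qed

text \<open>The lower bound on the constant \<open>a\<close> is the maximum principle: where the potential is largest,
  \<open>B : D\<^sup>2\<phi> \<le> 0\<close>, so \<open>g - a \<le> e\<close> there. The bound on the Hessian does not depend on the degrees of
  \<open>B\<close> and \<open>g\<close>, which is what permits the passage to measurable data.\<close>

lemma approximate_potential:
  fixes B :: "real ^ 'n \<Rightarrow> real ^ 'n ^ 'n" and g :: "real ^ 'n \<Rightarrow> real"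
  assumes B: "\<And>i j. \<exists>R. trig_poly R (\<lambda>x. of_real (B x $ i $ j))"
    and q: "\<And>x. norm (B x - mat 1) \<le> q" "q < 1"
    and g: "\<exists>M. trig_poly M (\<lambda>x. of_real (g x))" "\<And>x. \<bar>g x\<bar> \<le> G" "\<And>x. m \<le> g x" and e: "0 < e"
  obtains N f a where "(LINT x|lebesgue_on unit_cell. (norm (potential_hessian N f x))\<^sup>2) \<le> (G / (1 - q))\<^sup>2"
    "\<And>x. \<bar>B x \<bullet> potential_hessian N f x - (g x - a)\<bar> \<le> e" "m - e \<le> a"
proof -
  obtain R0 where R0: "\<And>i j. trig_poly (R0 i j) (\<lambda>x. of_real (B x $ i $ j))" using B by metis
  define R where "R = Max (range (\<lambda>(i, j). R0 i j))"
  have "R0 i j \<le> R" for i j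
    unfolding R_def by (rule Max_ge) (auto intro: image_eqI[of _ _ "(i, j)"])
  then have R: "trig_poly R (\<lambda>x. of_real (B x $ i $ j))" for i j
    using R0 trig_poly_mono by blast
  obtain M c where c: "(\<lambda>x. of_real (g x)) = trig_sum M c"
    using g(1) by (auto simp: trig_poly_def)
  have G0: "0 \<le> G" using g(2)[of 0] by simp
  have "coeff_norm M c \<le> G"
  proof (rule power2_le_imp_le[OF _ G0])
    have "(coeff_norm M c)\<^sup>2 = (LINT x|lebesgue_on unit_cell. (cmod (of_real (g x)))\<^sup>2)"
      by (simp add: coeff_norm_square parseval fun_cong[OF c])
    also have "\<dots> \<le> (LINT x|lebesgue_on (unit_cell :: (real ^ 'n) set). G\<^sup>2)"
      unfolding fun_cong[OF c]
    proof (intro integral_mono integrable_unit_cell continuous_intros)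
      show "(cmod (trig_sum M c x))\<^sup>2 \<le> G\<^sup>2" for x
        using g(2)[of x] unfolding fun_cong[OF c, symmetric] by (intro power_mono) auto
    qed
    finally show "(coeff_norm M c)\<^sup>2 \<le> G\<^sup>2" by simp
  qed
  then have cG: "coeff_norm M c / (1 - q) \<le> G / (1 - q)"
    using q(2) by (intro divide_right_mono) auto
  obtain N f a where f: "f 0 = 0" "coeff_norm N f \<le> coeff_norm M c / (1 - q)"
    and eq: "\<And>x. cmod ((\<Sum>i\<in>UNIV. \<Sum>j\<in>UNIV. of_real (B x $ i $ j) * hessian_sum N f i j x) - (trig_sum M c x - a)) \<le> e"
    by (rule approximate_solution[where B = B and g = c and M = M, OF R q e]) (rule that; assumption)
  have "(LINT x|lebesgue_on unit_cell. (norm (potential_hessian N f x))\<^sup>2) \<le> (coeff_norm N f)\<^sup>2"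
    by (rule integral_norm_potential_hessian[where f = f, OF f(1)])
  also have "\<dots> \<le> (G / (1 - q))\<^sup>2"
    using f(2) cG by (intro power_mono) auto
  finally have 1: "(LINT x|lebesgue_on unit_cell. (norm (potential_hessian N f x))\<^sup>2) \<le> (G / (1 - q))\<^sup>2" .
  have 2: "\<bar>B x \<bullet> potential_hessian N f x - (g x - Re a)\<bar> \<le> e" for x
  proof -
    have "B x \<bullet> potential_hessian N f x - (g x - Re a) =
        Re ((\<Sum>i\<in>UNIV. \<Sum>j\<in>UNIV. of_real (B x $ i $ j) * hessian_sum N f i j x) - (trig_sum M c x - a))"
      by (simp add: matrix_inner_eq potential_hessian_def fun_cong[OF c, symmetric])
    then show ?thesis using order_trans[OF abs_Re_le_cmod eq[of x]] by simp
  qed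
  obtain x0 where "\<And>v. (potential_hessian N f x0 *v v) \<bullet> v \<le> 0"
    using maximum_principle[of N f] by blast
  then have "B x0 \<bullet> potential_hessian N f x0 \<le> 0"
    using q(1)[of x0] q(2) by (intro near_identity_inner_nonpos transpose_potential_hessian) auto
  then have "m - e \<le> Re a" using 2[of x0] g(3)[of x0] by simp
  with 1 2 show ?thesis by (rule that)
qed

lemma integrable_mult_bounded:
  fixes u v :: "'a \<Rightarrow> real"
  assumes "integrable M u" "v \<in> borel_measurable M" "AE x in M. \<bar>v x\<bar> \<le> C"
  shows "integrable M (\<lambda>x. u x * v x)"
proof (rule Bochner_Integration.integrable_bound)
  show "integrable M (\<lambda>x. C * u x)" using assms(1) by simp
  show "AE x in M. norm (u x * v x) \<le> norm (C * u x)"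
    using assms(3)
  proof eventually_elim
    case (elim x)
    then have "\<bar>u x\<bar> * \<bar>v x\<bar> \<le> \<bar>u x\<bar> * \<bar>C\<bar>" by (intro mult_left_mono) auto
    then show ?case by (simp add: abs_mult mult.commute)
  qed
  show "(\<lambda>x. u x * v x) \<in> borel_measurable M"
    using assms(1,2) by measurable
qed

text \<open>If \<open>B\<^sub>k\<close> and \<open>g\<^sub>k\<close> approximate \<open>B\<close> and \<open>g\<close> and \<open>B\<^sub>k : H\<^sub>k\<close> is close to \<open>g\<^sub>k - c\<^sub>k\<close>, then orthogonality turns
  \<open>\<integral> \<rho> (g\<^sub>k - c\<^sub>k)\<close> into \<open>\<integral> \<rho> (B\<^sub>k - B) : H\<^sub>k\<close> up to a small error. This tends to zero
  since \<open>\<rho> \<bar>B\<^sub>k - B\<bar>\<close> tends to zero in \<open>L\<^sup>2\<close> by dominated convergence while the Hessians \<open>H\<^sub>k\<close> are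
  bounded in \<open>L\<^sup>2\<close>.\<close>

lemma weighted_integral_limit:
  fixes B :: "real ^ 'n \<Rightarrow> real ^ 'n ^ 'n" and \<rho> g :: "real ^ 'n \<Rightarrow> real"
  assumes Bm: "B \<in> borel_measurable lebesgue" and gm: "g \<in> borel_measurable lebesgue"
    and \<rho>m: "\<rho> \<in> borel_measurable lebesgue"
    and q: "AE x in lebesgue_on unit_cell. norm (B x - mat 1) \<le> q" "0 \<le> q" "q < 1"
    and g: "AE x in lebesgue_on unit_cell. m \<le> g x \<and> g x \<le> G"
    and \<rho>: "integrable (lebesgue_on unit_cell) (\<lambda>x. (\<rho> x)\<^sup>2)"
    and orth: "\<And>N f. (LINT x|lebesgue_on unit_cell. \<rho> x * (B x \<bullet> potential_hessian N f x)) = 0"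
  obtains c \<epsilon> :: "nat \<Rightarrow> real" where "\<And>k. m - \<epsilon> k \<le> c k" "\<epsilon> \<longlonglongrightarrow> 0"
    "(\<lambda>k. c k * (LINT x|lebesgue_on unit_cell. \<rho> x)) \<longlonglongrightarrow> (LINT x|lebesgue_on unit_cell. \<rho> x * g x)"
proof -
  let ?M = "lebesgue_on (unit_cell :: (real ^ 'n) set)"
  interpret finite_measure ?M
    by (rule finite_measure_lebesgue_on[OF unit_cell_lmeasurable])
  have meas: "f \<in> borel_measurable lebesgue \<Longrightarrow> f \<in> borel_measurable ?M" for f :: "real ^ 'n \<Rightarrow> 'b :: topological_space"
    by (rule measurable_restrict_space1)
  note [measurable] = meas[OF Bm] meas[OF gm] meas[OF \<rho>m]
  define C where "C = cball (mat 1 :: real ^ 'n ^ 'n) q \<times> {m..G}"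
  \<comment> \<open>At most half of the gap between \<open>q\<close> and \<open>1\<close>, so that the approximations still contract uniformly.\<close>
  define \<epsilon> where "\<epsilon> k = (1 - q) / 2 / real (Suc k)" for k
  have \<epsilon>0: "\<epsilon> \<longlonglongrightarrow> 0"
    unfolding \<epsilon>_def using tendsto_mult[OF tendsto_const[of "(1 - q) / 2"] LIMSEQ_Suc[OF lim_1_over_n]] by simp
  have \<epsilon>pos: "0 < \<epsilon> k" for k using q by (simp add: \<epsilon>_def)
  have \<epsilon>le: "\<epsilon> k \<le> (1 - q) / 2" for k
    using divide_left_mono[of 1 "real (Suc k)" "(1 - q) / 2"] q(3) by (simp add: \<epsilon>_def)
  have gG: "m \<le> G"
  proof -
    have "\<not> (AE x in ?M. False)"
    proof
      assume "AE x in ?M. False"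
      then have "(LINT x|?M. (1 :: real)) = (LINT x|?M. 0)"
        by (intro integral_cong_AE) auto
      then show False by simp
    qed
    moreover have "AE x in ?M. False" if "\<not> m \<le> G"
      using g by eventually_elim (use that in auto)
    ultimately show ?thesis by blast
  qed
  have "mat 1 \<in> cball (mat 1 :: real ^ 'n ^ 'n) q" using q(2) by simp
  then have C: "convex C" "closed C" "C \<noteq> {}"
    unfolding C_def using gG by (auto intro!: convex_Times closed_Times)
  have FC: "AE x in lebesgue. x \<in> unit_cell \<longrightarrow> (B x, g x) \<in> C"
    using q(1) g unfolding AE_unit_cell_iff
    by eventually_elim (auto simp: C_def dist_norm norm_minus_commute)
  have Fm: "(\<lambda>x. (B x, g x)) \<in> borel_measurable lebesgue"
    using Bm gm by (simp add: borel_measurable_Pair)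
  obtain P where P: "\<And>k b. \<exists>M. trig_poly M (\<lambda>x. of_real (P k x \<bullet> b))"
    "\<And>k x. \<exists>y\<in>C. dist (P k x) y < \<epsilon> k"
    "AE x in lebesgue. x \<in> unit_cell \<longrightarrow> (\<lambda>k. P k x) \<longlonglongrightarrow> (B x, g x)"
    by (rule trig_poly_approximation[OF Fm C FC \<epsilon>pos \<epsilon>0]) blast
  define Bk where "Bk k x = fst (P k x)" for k x
  define gk where "gk k x = snd (P k x)" for k x
  have Bk_trig: "\<exists>R. trig_poly R (\<lambda>x. of_real (Bk k x $ i $ j))" for k i j
  proof -
    have "P k x \<bullet> (axis i (axis j 1), 0) = Bk k x $ i $ j" for x
      by (simp add: Bk_def inner_prod_def inner_axis)
    then show ?thesis using P(1)[of k "(axis i (axis j 1), 0)"] by simp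
  qed
  have gk_trig: "\<exists>M. trig_poly M (\<lambda>x. of_real (gk k x))" for k
  proof -
    have "P k x \<bullet> (0, 1) = gk k x" for x
      by (simp add: gk_def inner_prod_def)
    then show ?thesis using P(1)[of k "(0, 1)"] by simp
  qed
  \<comment> \<open>A common contraction factor for all approximating coefficients.\<close>
  define q' where "q' = (1 + q) / 2"
  have q': "q' < 1" using q by (simp add: q'_def)
  define G' where "G' = \<bar>m\<bar> + \<bar>G\<bar> + 1"
  have near: "norm (Bk k x - mat 1) \<le> q' \<and> m - \<epsilon> k \<le> gk k x \<and> \<bar>gk k x\<bar> \<le> G'" for k x
  proof -
    obtain y where y: "y \<in> C" "dist (P k x) y < \<epsilon> k" using P(2) by blast
    have "dist (Bk k x) (fst y) < \<epsilon> k" "dist (gk k x) (snd y) < \<epsilon> k"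
      using y(2) dist_fst_le[of "P k x" y] dist_snd_le[of "P k x" y] by (auto simp: Bk_def gk_def)
    moreover have "dist (fst y) (mat 1) \<le> q" "m \<le> snd y" "snd y \<le> G"
      using y(1) by (auto simp: C_def dist_commute)
    moreover have "dist (Bk k x) (mat 1) \<le> dist (Bk k x) (fst y) + dist (fst y) (mat 1)"
      by (rule dist_triangle)
    moreover have "\<epsilon> k < 1" using \<epsilon>le[of k] q by simp
    ultimately show ?thesis
      using \<epsilon>le[of k] by (auto simp: dist_norm q'_def G'_def field_simps)
  qed
  define solves where "solves k N f a \<longleftrightarrow> (LINT x|?M. (norm (potential_hessian N f x))\<^sup>2) \<le> (G' / (1 - q'))\<^sup>2 \<and>
    (\<forall>x. \<bar>Bk k x \<bullet> potential_hessian N f x - (gk k x - a)\<bar> \<le> \<epsilon> k) \<and> m - \<epsilon> k - \<epsilon> k \<le> a" for k N f a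
  have "\<exists>N f a. solves k N f a" for k
  proof -
    have k: "norm (Bk k x - mat 1) \<le> q'" "\<bar>gk k x\<bar> \<le> G'" "m - \<epsilon> k \<le> gk k x" for x
      using near by auto
    show ?thesis
    proof (rule approximate_potential[where B = "Bk k" and g = "gk k", OF Bk_trig k(1) q' gk_trig k(2,3) \<epsilon>pos[of k]])
      fix N f a
      assume "(LINT x|?M. (norm (potential_hessian N f x))\<^sup>2) \<le> (G' / (1 - q'))\<^sup>2"
        "\<And>x. \<bar>Bk k x \<bullet> potential_hessian N f x - (gk k x - a)\<bar> \<le> \<epsilon> k" "m - \<epsilon> k - \<epsilon> k \<le> a"
      then have "solves k N f a" by (simp add: solves_def)
      then show ?thesis by blast
    qed
  qed
  then obtain N f c where "\<And>k. solves k (N k) (f k) (c k)"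
    by metis
  then have Hbound: "\<And>k. (LINT x|?M. (norm (potential_hessian (N k) (f k) x))\<^sup>2) \<le> (G' / (1 - q'))\<^sup>2"
    and eq: "\<And>k x. \<bar>Bk k x \<bullet> potential_hessian (N k) (f k) x - (gk k x - c k)\<bar> \<le> \<epsilon> k"
    and c: "\<And>k. m - \<epsilon> k - \<epsilon> k \<le> c k"
    by (simp_all add: solves_def)
  define H where "H k = potential_hessian (N k) (f k)" for k
  have Hc: "continuous_on UNIV (H k)" for k
    unfolding H_def by (rule continuous_on_potential_hessian)
  have trig_cont: "continuous_on UNIV u" if "\<exists>R. trig_poly R (\<lambda>x. of_real (u x))" for u :: "real ^ 'n \<Rightarrow> real"
  proof -
    obtain R d where "(\<lambda>x. of_real (u x)) = trig_sum R d"
      using \<open>\<exists>R. trig_poly R (\<lambda>x. of_real (u x))\<close> by (auto simp: trig_poly_def)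
    then have "u = (\<lambda>x. Re (trig_sum R d x))" by (metis Re_complex_of_real)
    then show ?thesis by (simp add: continuous_intros)
  qed
  have "continuous_on UNIV (\<lambda>x. \<chi> i j. Bk k x $ i $ j)" for k
    by (intro continuous_on_vec_lambda trig_cont Bk_trig)
  then have Bkc: "continuous_on UNIV (Bk k)" for k by simp
  have gkc: "continuous_on UNIV (gk k)" for k by (rule trig_cont[OF gk_trig])
  have cm: "continuous_on UNIV u \<Longrightarrow> u \<in> borel_measurable ?M" for u :: "real ^ 'n \<Rightarrow> 'b :: topological_space"
    by (intro meas measurable_completion) (simp add: borel_measurable_continuous_onI)
  note [measurable] = cm[OF Hc] cm[OF Bkc] cm[OF gkc]
  have \<rho>int: "integrable ?M \<rho>"
    using Cauchy_Schwarz_integral(1)[of \<rho> ?M "\<lambda>x. 1"] \<rho> by simp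
  define S where "S = (LINT x|?M. \<rho> x)"
  have lim: "AE x in ?M. (\<lambda>k. Bk k x) \<longlonglongrightarrow> B x \<and> (\<lambda>k. gk k x) \<longlonglongrightarrow> g x"
    using P(3) unfolding AE_unit_cell_iff
    by eventually_elim (auto simp: Bk_def gk_def dest: tendsto_fst tendsto_snd)
  have g_lim: "(\<lambda>k. LINT x|?M. \<rho> x * gk k x) \<longlonglongrightarrow> (LINT x|?M. \<rho> x * g x)"
  proof (rule integral_dominated_convergence[where w = "\<lambda>x. G' * \<bar>\<rho> x\<bar>"])
    show "integrable ?M (\<lambda>x. G' * \<bar>\<rho> x\<bar>)" using \<rho>int by simp
    show "AE x in ?M. (\<lambda>k. \<rho> x * gk k x) \<longlonglongrightarrow> \<rho> x * g x"
      using lim by eventually_elim (auto intro: tendsto_mult)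
    show "AE x in ?M. norm (\<rho> x * gk k x) \<le> G' * \<bar>\<rho> x\<bar>" for k
    proof (rule AE_I2)
      fix x
      have "\<bar>\<rho> x\<bar> * \<bar>gk k x\<bar> \<le> \<bar>\<rho> x\<bar> * G'" using near[of k x] by (intro mult_left_mono) auto
      then show "norm (\<rho> x * gk k x) \<le> G' * \<bar>\<rho> x\<bar>" by (simp add: abs_mult mult.commute)
    qed
  qed simp_all
  have B_diff: "AE x in ?M. norm (Bk k x - B x) \<le> 2" for k
    using q(1)
  proof eventually_elim
    case (elim x)
    then show ?case
      using near[of k x] q q' norm_triangle_ineq4[of "Bk k x - mat 1" "B x - mat 1"]
      unfolding diff_diff_eq2 diff_add_cancel by linarith
  qed
  have sq_le: "AE x in ?M. norm ((\<rho> x * norm (Bk k x - B x))\<^sup>2) \<le> 4 * (\<rho> x)\<^sup>2" for k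
    using B_diff[of k]
  proof eventually_elim
    case (elim x)
    then have "(norm (Bk k x - B x))\<^sup>2 \<le> 2\<^sup>2" by (intro power_mono) auto
    then have "(\<rho> x)\<^sup>2 * (norm (Bk k x - B x))\<^sup>2 \<le> (\<rho> x)\<^sup>2 * 4" by (intro mult_left_mono) auto
    then show ?case by (simp add: power_mult_distrib)
  qed
  have sq_int: "integrable ?M (\<lambda>x. (\<rho> x * norm (Bk k x - B x))\<^sup>2)" for k
  proof (rule Bochner_Integration.integrable_bound)
    show "integrable ?M (\<lambda>x. 4 * (\<rho> x)\<^sup>2)" using \<rho> by simp
    show "AE x in ?M. norm ((\<rho> x * norm (Bk k x - B x))\<^sup>2) \<le> norm (4 * (\<rho> x)\<^sup>2)"
      using sq_le[of k] by simp
  qed measurable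
  have sq_lim: "(\<lambda>k. LINT x|?M. (\<rho> x * norm (Bk k x - B x))\<^sup>2) \<longlonglongrightarrow> (LINT x|?M. 0)"
  proof (rule integral_dominated_convergence[where w = "\<lambda>x. 4 * (\<rho> x)\<^sup>2"])
    show "AE x in ?M. (\<lambda>k. (\<rho> x * norm (Bk k x - B x))\<^sup>2) \<longlonglongrightarrow> 0"
      using lim
    proof eventually_elim
      case (elim x)
      then have "(\<lambda>k. (\<rho> x * norm (Bk k x - B x))\<^sup>2) \<longlonglongrightarrow> (\<rho> x * norm (B x - B x))\<^sup>2"
        by (intro tendsto_intros) auto
      then show ?case by simp
    qed
    show "integrable ?M (\<lambda>x. 4 * (\<rho> x)\<^sup>2)" using \<rho> by simp
    show "(\<lambda>x. (\<rho> x * norm (Bk k x - B x))\<^sup>2) \<in> borel_measurable ?M" for k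
      by measurable
    show "AE x in ?M. norm ((\<rho> x * norm (Bk k x - B x))\<^sup>2) \<le> 4 * (\<rho> x)\<^sup>2" for k
      by (rule sq_le)
  qed simp
  define T where "T k = (LINT x|?M. \<rho> x * ((Bk k x - B x) \<bullet> H k x))" for k
  have H_sq: "integrable ?M (\<lambda>x. (norm (H k x))\<^sup>2)" for k
    by (intro integrable_unit_cell continuous_intros Hc)
  have prod_int: "integrable ?M (\<lambda>x. (\<rho> x * norm (Bk k x - B x)) * norm (H k x))" for k
    by (rule Cauchy_Schwarz_integral(1)[OF _ _ sq_int H_sq]) measurable
  have prod_le: "norm (\<rho> x * ((Bk k x - B x) \<bullet> H k x)) \<le> \<bar>(\<rho> x * norm (Bk k x - B x)) * norm (H k x)\<bar>" for k x
    using Cauchy_Schwarz_ineq2[of "Bk k x - B x" "H k x"]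
    by (simp add: abs_mult mult.assoc mult_left_mono)
  have T_int: "integrable ?M (\<lambda>x. \<rho> x * ((Bk k x - B x) \<bullet> H k x))" for k
  proof (rule Bochner_Integration.integrable_bound[OF prod_int[of k]])
    show "AE x in ?M. norm (\<rho> x * ((Bk k x - B x) \<bullet> H k x)) \<le> norm ((\<rho> x * norm (Bk k x - B x)) * norm (H k x))"
      unfolding real_norm_def using prod_le by (intro AE_I2) simp
  qed measurable
  have T_le: "\<bar>T k\<bar> \<le> sqrt (LINT x|?M. (\<rho> x * norm (Bk k x - B x))\<^sup>2) * (G' / (1 - q'))" for k
  proof -
    have "\<bar>T k\<bar> \<le> (LINT x|?M. norm (\<rho> x * ((Bk k x - B x) \<bullet> H k x)))"
      unfolding T_def real_norm_def[symmetric] by (rule integral_norm_bound)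
    also have "\<dots> \<le> (LINT x|?M. \<bar>(\<rho> x * norm (Bk k x - B x)) * norm (H k x)\<bar>)"
      by (intro integral_mono integrable_norm T_int integrable_abs prod_int prod_le)
    also have "\<dots> \<le> sqrt (LINT x|?M. (\<rho> x * norm (Bk k x - B x))\<^sup>2) * sqrt (LINT x|?M. (norm (H k x))\<^sup>2)"
      by (rule Cauchy_Schwarz_integral(2)[OF _ _ sq_int H_sq]) measurable
    also have "\<dots> \<le> sqrt (LINT x|?M. (\<rho> x * norm (Bk k x - B x))\<^sup>2) * (G' / (1 - q'))"
      using Hbound[of k] q'
      by (intro mult_left_mono real_le_lsqrt) (auto simp: H_def G'_def)
    finally show ?thesis .
  qed
  have T_lim: "T \<longlonglongrightarrow> 0"
  proof (rule Lim_null_comparison)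
    show "\<forall>\<^sub>F k in sequentially. norm (T k) \<le> sqrt (LINT x|?M. (\<rho> x * norm (Bk k x - B x))\<^sup>2) * (G' / (1 - q'))"
      using T_le by simp
    have "(\<lambda>k. sqrt (LINT x|?M. (\<rho> x * norm (Bk k x - B x))\<^sup>2) * (G' / (1 - q'))) \<longlonglongrightarrow> sqrt (LINT x|?M. 0) * (G' / (1 - q'))"
      by (intro tendsto_intros sq_lim)
    then show "(\<lambda>k. sqrt (LINT x|?M. (\<rho> x * norm (Bk k x - B x))\<^sup>2) * (G' / (1 - q'))) \<longlonglongrightarrow> 0"
      by simp
  qed
  define E where "E k x = Bk k x \<bullet> H k x - (gk k x - c k)" for k x
  have [measurable]: "E k \<in> borel_measurable ?M" for k
    unfolding E_def by measurable
  have E_le: "\<bar>E k x\<bar> \<le> \<epsilon> k" for k x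
    using eq[of k x] by (simp add: E_def H_def)
  have E_int: "integrable ?M (\<lambda>x. \<rho> x * E k x)" for k
    by (rule integrable_mult_bounded[OF \<rho>int, where C = "\<epsilon> k"]) (auto simp: E_le)
  have gk_int: "integrable ?M (\<lambda>x. \<rho> x * gk k x)" for k
    by (rule integrable_mult_bounded[OF \<rho>int, where C = G']) (use near in auto)
  have key: "c k * S = (LINT x|?M. \<rho> x * gk k x) + (LINT x|?M. \<rho> x * E k x) - T k" for k
  proof -
    have "\<rho> x * (B x \<bullet> H k x) = \<rho> x * gk k x + \<rho> x * E k x - c k * \<rho> x - \<rho> x * ((Bk k x - B x) \<bullet> H k x)" for x
      by (simp add: E_def inner_diff_left algebra_simps)
    then have "(LINT x|?M. \<rho> x * (B x \<bullet> H k x)) =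
        (LINT x|?M. \<rho> x * gk k x) + (LINT x|?M. \<rho> x * E k x) - c k * S - T k"
      using gk_int E_int \<rho>int T_int by (simp add: S_def T_def)
    then show ?thesis using orth[of "N k" "f k"] by (simp add: H_def)
  qed
  have E_lim: "(\<lambda>k. LINT x|?M. \<rho> x * E k x) \<longlonglongrightarrow> 0"
  proof (rule Lim_null_comparison)
    have "norm (LINT x|?M. \<rho> x * E k x) \<le> \<epsilon> k * (LINT x|?M. \<bar>\<rho> x\<bar>)" for k
    proof -
      have "norm (LINT x|?M. \<rho> x * E k x) \<le> (LINT x|?M. norm (\<rho> x * E k x))"
        by (rule integral_norm_bound)
      also have "\<dots> \<le> (LINT x|?M. \<epsilon> k * \<bar>\<rho> x\<bar>)"
      proof (intro integral_mono integrable_norm E_int)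
        show "integrable ?M (\<lambda>x. \<epsilon> k * \<bar>\<rho> x\<bar>)" using \<rho>int by simp
        have "\<bar>\<rho> x\<bar> * \<bar>E k x\<bar> \<le> \<bar>\<rho> x\<bar> * \<epsilon> k" for x
          using E_le by (intro mult_left_mono) auto
        then show "norm (\<rho> x * E k x) \<le> \<epsilon> k * \<bar>\<rho> x\<bar>" for x
          by (simp add: abs_mult mult.commute)
      qed
      finally show ?thesis by simp
    qed
    then show "\<forall>\<^sub>F k in sequentially. norm (LINT x|?M. \<rho> x * E k x) \<le> \<epsilon> k * (LINT x|?M. \<bar>\<rho> x\<bar>)" by simp
    show "(\<lambda>k. \<epsilon> k * (LINT x|?M. \<bar>\<rho> x\<bar>)) \<longlonglongrightarrow> 0"
      using tendsto_mult_right[OF \<epsilon>0] by simp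
  qed
  have "(\<lambda>k. c k * S) \<longlonglongrightarrow> (LINT x|?M. \<rho> x * g x) + 0 - 0"
    unfolding key by (intro tendsto_intros g_lim E_lim T_lim)
  then have "(\<lambda>k. c k * S) \<longlonglongrightarrow> (LINT x|?M. \<rho> x * g x)" by simp
  moreover have "(\<lambda>k. \<epsilon> k + \<epsilon> k) \<longlonglongrightarrow> 0"
    using tendsto_add[OF \<epsilon>0 \<epsilon>0] by simp
  ultimately show ?thesis
    using c by (intro that[of "\<lambda>k. \<epsilon> k + \<epsilon> k" c]) (auto simp: S_def algebra_simps)
qed

text \<open>The integral is the limit of \<open>c\<^sub>k \<integral> \<rho>\<close> with \<open>c\<^sub>k\<close> asymptotically at least \<open>m\<close>. Both signs of
  \<open>\<integral> \<rho>\<close> are treated because positivity of \<open>\<integral> \<rho>\<close> is itself derived from the second conclusion.\<close>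

lemma weighted_integral_bounds:
  fixes B :: "real ^ 'n \<Rightarrow> real ^ 'n ^ 'n" and \<rho> g :: "real ^ 'n \<Rightarrow> real"
  assumes "B \<in> borel_measurable lebesgue" "g \<in> borel_measurable lebesgue"
    and "\<rho> \<in> borel_measurable lebesgue"
    and "AE x in lebesgue_on unit_cell. norm (B x - mat 1) \<le> q" "0 \<le> q" "q < 1"
    and "AE x in lebesgue_on unit_cell. m \<le> g x \<and> g x \<le> G"
    and "integrable (lebesgue_on unit_cell) (\<lambda>x. (\<rho> x)\<^sup>2)"
    and "\<And>N f. (LINT x|lebesgue_on unit_cell. \<rho> x * (B x \<bullet> potential_hessian N f x)) = 0"
  shows "0 \<le> (LINT x|lebesgue_on unit_cell. \<rho> x) \<Longrightarrow>
      m * (LINT x|lebesgue_on unit_cell. \<rho> x) \<le> (LINT x|lebesgue_on unit_cell. \<rho> x * g x)"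
    and "(LINT x|lebesgue_on unit_cell. \<rho> x) \<le> 0 \<Longrightarrow>
      (LINT x|lebesgue_on unit_cell. \<rho> x * g x) \<le> m * (LINT x|lebesgue_on unit_cell. \<rho> x)"
proof -
  let ?S = "LINT x|lebesgue_on unit_cell. \<rho> x"
  obtain c \<epsilon> where c: "\<And>k. m - \<epsilon> k \<le> c k" "\<epsilon> \<longlonglongrightarrow> 0"
    "(\<lambda>k. c k * ?S) \<longlonglongrightarrow> (LINT x|lebesgue_on unit_cell. \<rho> x * g x)"
    by (rule weighted_integral_limit[OF assms]) (rule that; assumption)
  have lim: "(\<lambda>k. (m - \<epsilon> k) * ?S) \<longlonglongrightarrow> m * ?S"
    using tendsto_mult_right[OF tendsto_diff[OF tendsto_const c(2)]] by simp
  show "0 \<le> ?S \<Longrightarrow> m * ?S \<le> (LINT x|lebesgue_on unit_cell. \<rho> x * g x)"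
    by (rule LIMSEQ_le[OF lim c(3)]) (auto intro!: mult_right_mono c(1))
  show "?S \<le> 0 \<Longrightarrow> (LINT x|lebesgue_on unit_cell. \<rho> x * g x) \<le> m * ?S"
    by (rule LIMSEQ_le[OF c(3) lim]) (auto intro!: mult_right_mono_neg c(1))
qed

section \<open>Ellipticity, the Cordes condition and the effective matrix\<close>

lemma norm_matrix_vector_mult_le:
  fixes M :: "real ^ 'n ^ 'm"
  shows "norm (M *v x) \<le> norm M * norm x"
proof -
  have "norm (M *v x) \<le> L2_set (\<lambda>i. norm (M $ i) * norm x) UNIV"
    unfolding norm_vec_def[of "M *v x"]
    by (rule L2_set_mono) (auto simp: matrix_vector_mul_component Cauchy_Schwarz_ineq2)
  also have "\<dots> = norm M * norm x"
    unfolding norm_vec_def[of M] by (rule L2_set_left_distrib[symmetric]) simp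
  finally show ?thesis .
qed

lemma abs_quadratic_form_le:
  fixes M :: "real ^ 'n ^ 'n"
  shows "\<bar>(M *v x) \<bullet> x\<bar> \<le> norm M * (norm x)\<^sup>2"
proof -
  have "\<bar>(M *v x) \<bullet> x\<bar> \<le> norm (M *v x) * norm x"
    by (rule Cauchy_Schwarz_ineq2)
  also have "\<dots> \<le> (norm M * norm x) * norm x"
    by (intro mult_right_mono norm_matrix_vector_mult_le) simp
  finally show ?thesis by (simp add: power2_eq_square)
qed

lemma bounded_linear_transpose: "bounded_linear (transpose :: real ^ 'n ^ 'n \<Rightarrow> real ^ 'n ^ 'n)"
  unfolding linear_conv_bounded_linear[symmetric]
  by (rule linearI) (simp_all add: transpose_def vec_eq_iff)

lemma bounded_linear_quadratic_form: "bounded_linear (\<lambda>M :: real ^ 'n ^ 'n. (M *v x) \<bullet> x)"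
  unfolding linear_conv_bounded_linear[symmetric]
  by (rule linearI) (simp_all add: matrix_vector_mult_add_rdistrib inner_add_left scaleR_matrix_vector_assoc[symmetric])

text \<open>With \<open>y = M x\<close>, the Cauchy-Schwarz inequality of the form gives \<open>\<bar>y\<bar>\<^sup>4 \<le> (M x \<cdot> x) (M y \<cdot> y)\<close>,
  hence \<open>\<bar>M x\<bar> \<le> c \<bar>x\<bar>\<close>; the square of the Frobenius norm is the sum over the images of the unit vectors.\<close>

lemma norm_le_sqrt_card_mult:
  fixes M :: "real ^ 'n ^ 'n"
  assumes sym: "transpose M = M" and nonneg: "\<And>x. 0 \<le> (M *v x) \<bullet> x"
    and le: "\<And>x. (M *v x) \<bullet> x \<le> c * (norm x)\<^sup>2" and c: "0 \<le> c"
  shows "norm M \<le> sqrt (real CARD('n)) * c"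
proof -
  have Mx: "(norm (M *v x))\<^sup>2 \<le> (c * norm x)\<^sup>2" for x
  proof (cases "M *v x = 0")
    case False
    define y where "y = M *v x"
    have "((norm y)\<^sup>2)\<^sup>2 \<le> ((M *v x) \<bullet> x) * ((M *v y) \<bullet> y)"
      using psd_Cauchy_Schwarz[OF sym nonneg, of x y] by (simp add: y_def power2_norm_eq_inner)
    also have "\<dots> \<le> (c * (norm x)\<^sup>2) * (c * (norm y)\<^sup>2)"
      using c by (intro mult_mono le nonneg) auto
    finally have "(norm y)\<^sup>2 * (norm y)\<^sup>2 \<le> (c * norm x)\<^sup>2 * (norm y)\<^sup>2"
      by (simp add: power2_eq_square mult_ac)
    then have "(norm y)\<^sup>2 \<le> (c * norm x)\<^sup>2"
      by (rule mult_right_le_imp_le) (use False in \<open>simp add: y_def\<close>)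
    then show ?thesis by (simp add: y_def)
  qed simp
  have "(norm M)\<^sup>2 = (\<Sum>j\<in>UNIV. (norm (M *v axis j 1))\<^sup>2)"
    by (subst power2_norm_eq_inner, subst matrix_inner_eq, subst sum.swap)
      (simp add: power2_norm_eq_inner inner_vec_def matrix_vector_mult_basis column_def)
  also have "\<dots> \<le> (\<Sum>j\<in>(UNIV :: 'n set). c\<^sup>2)"
    using Mx[of "axis _ 1"] by (intro sum_mono) simp
  also have "\<dots> = (sqrt (real CARD('n)) * c)\<^sup>2"
    by (simp add: power_mult_distrib)
  finally show ?thesis
    by (rule power2_le_imp_le) (use c in simp)
qed

text \<open>The exceptional null set of the ellipticity bounds may depend on \<open>\<xi>\<close>. Countably many \<open>\<xi>\<close> from a dense
  set share one null set, and off this set the bounds extend to all \<open>\<xi>\<close> by continuity.\<close>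

lemma elliptic_class_AE:
  fixes A :: "real ^ 'n \<Rightarrow> real ^ 'n ^ 'n"
  assumes A: "A \<in> elliptic_class lam Lam"
  shows "AE x in lebesgue. transpose (A x) = A x \<and>
    (\<forall>\<xi>. lam * (norm \<xi>)\<^sup>2 \<le> (A x *v \<xi>) \<bullet> \<xi> \<and> (A x *v \<xi>) \<bullet> \<xi> \<le> Lam * (norm \<xi>)\<^sup>2)"
proof -
  obtain D :: "(real ^ 'n) set" where D: "countable D" "\<And>X. open X \<Longrightarrow> X \<noteq> {} \<Longrightarrow> \<exists>d\<in>D. d \<in> X"
    using countable_dense_exists by metis
  define S where "S x = {\<xi>. lam * (norm \<xi>)\<^sup>2 \<le> (A x *v \<xi>) \<bullet> \<xi> \<and> (A x *v \<xi>) \<bullet> \<xi> \<le> Lam * (norm \<xi>)\<^sup>2}" for x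
  have "AE x in lebesgue. \<xi> \<in> S x" for \<xi>
    using A by (cases "\<xi> = 0") (auto simp: S_def elliptic_class_def)
  then have "AE x in lebesgue. \<forall>\<xi>\<in>D. \<xi> \<in> S x"
    by (simp add: AE_ball_countable[OF D(1)])
  moreover have "AE x in lebesgue. transpose (A x) = A x"
    using A by (simp add: elliptic_class_def)
  ultimately show ?thesis
  proof eventually_elim
    case (elim x)
    have "closed (S x)"
      unfolding S_def
      by (intro closed_Collect_conj closed_Collect_le continuous_intros
          continuous_on_inner linear_continuous_on[OF matrix_vector_mul_bounded_linear])
    then have "S x = UNIV"
      using D(2)[of "- S x"] elim(1) by auto
    then show ?case using elim(2) unfolding S_def by blast
  qed
qed

text \<open>The factor \<open>tr M / \<bar>M\<bar>\<^sup>2\<close> is the one that minimises the distance of a multiple of \<open>M\<close> to the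
  identity, and the squared minimal distance is \<open>n - (tr M)\<^sup>2 / \<bar>M\<bar>\<^sup>2\<close>.\<close>

lemma cordes_normalisation:
  fixes M :: "real ^ 'n ^ 'n"
  assumes tr: "0 < trace M" and \<delta>: "0 < \<delta>"
    and cordes: "(norm M)\<^sup>2 / (trace M)\<^sup>2 \<le> 1 / (real CARD('n) - 1 + \<delta>)"
  shows "norm ((trace M / (norm M)\<^sup>2) *\<^sub>R M - mat 1) \<le> sqrt (1 - \<delta>)"
proof -
  have "M \<noteq> 0" using tr by (auto simp: trace_def)
  then have N: "0 < (norm M)\<^sup>2" by simp
  have n: "0 < real CARD('n) - 1 + \<delta>"
    using \<delta> zero_less_card_finite[where 'a = 'n] by linarith
  have "(real CARD('n) - 1 + \<delta>) * (norm M)\<^sup>2 \<le> (trace M)\<^sup>2"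
    using cordes n tr by (simp add: field_simps)
  then have le: "real CARD('n) - 1 + \<delta> \<le> (trace M)\<^sup>2 / (norm M)\<^sup>2"
    using N by (simp add: field_simps)
  define t where "t = trace M / (norm M)\<^sup>2"
  have "(norm (t *\<^sub>R M - mat 1))\<^sup>2 = t\<^sup>2 * (norm M)\<^sup>2 - 2 * t * trace M + real CARD('n)"
    by (simp only: power2_norm_eq_inner)
      (simp add: inner_diff_left inner_diff_right inner_mat_1[of M] inner_mat_1[of "mat 1"]
        inner_commute[of "mat 1" M]
        trace_I power2_eq_square algebra_simps)
  also have "\<dots> = real CARD('n) - (trace M)\<^sup>2 / (norm M)\<^sup>2"
    using N unfolding t_def by (simp add: power2_eq_square field_simps)
  also have "\<dots> \<le> 1 - \<delta>" using le by simp
  finally show ?thesis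
    unfolding t_def by (rule real_le_rsqrt)
qed

lemma elliptic_normalisation_bounds:
  fixes M :: "real ^ 'n ^ 'n"
  assumes lam: "0 < lam" and K: "norm M \<le> K"
    and ell: "\<And>x. lam * (norm x)\<^sup>2 \<le> (M *v x) \<bullet> x"
  shows "0 < trace M" and "lam / K\<^sup>2 \<le> trace M / (norm M)\<^sup>2" and "trace M / (norm M)\<^sup>2 \<le> real CARD('n) / lam"
proof -
  have "(\<Sum>i\<in>(UNIV :: 'n set). lam) \<le> trace M"
    unfolding trace_def using ell[of "axis _ 1"]
    by (intro sum_mono) (simp add: matrix_entry_eq_inner[symmetric])
  then have "real CARD('n) * lam \<le> trace M" by simp
  moreover have "lam \<le> real CARD('n) * lam"
    using lam zero_less_card_finite[where 'a = 'n] by (simp add: Suc_leI)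
  ultimately have tr: "lam \<le> trace M" by simp
  then show tr0: "0 < trace M" using lam by simp
  then have "M \<noteq> 0" by (auto simp: trace_def)
  then have N: "0 < norm M" by simp
  have "trace M \<le> norm M * norm (mat 1 :: real ^ 'n ^ 'n)"
    using norm_cauchy_schwarz[of M "mat 1"] by (simp add: inner_mat_1)
  moreover have "norm (mat 1 :: real ^ 'n ^ 'n) = sqrt (real CARD('n))"
    by (simp add: matrix_norm_eq inner_mat_1 trace_I)
  ultimately have "(trace M)\<^sup>2 \<le> (norm M * sqrt (real CARD('n)))\<^sup>2"
    using tr0 by (intro power_mono) auto
  then have sq: "trace M * trace M \<le> (norm M)\<^sup>2 * real CARD('n)"
    by (simp add: power_mult_distrib power2_eq_square[of "trace M"])
  have "lam * trace M \<le> trace M * trace M"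
    using tr tr0 by (intro mult_right_mono) auto
  then have "lam * trace M \<le> real CARD('n) * (norm M)\<^sup>2"
    using sq by (simp add: mult.commute)
  then show "trace M / (norm M)\<^sup>2 \<le> real CARD('n) / lam"
    using lam N by (simp add: field_simps)
  have "(norm M)\<^sup>2 \<le> K\<^sup>2" using K by (intro power_mono) auto
  then show "lam / K\<^sup>2 \<le> trace M / (norm M)\<^sup>2"
    using tr lam N by (intro frac_le) auto
qed

lemma L2_per_imp_integrable:
  assumes "f \<in> L2_per"
  shows "f \<in> borel_measurable (lebesgue_on unit_cell)" "integrable (lebesgue_on unit_cell) f"
    "L1_norm f \<le> L2_norm f"
proof -
  let ?M = "lebesgue_on (unit_cell :: (real ^ 'a) set)"
  interpret finite_measure ?M
    by (rule finite_measure_lebesgue_on[OF unit_cell_lmeasurable])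
  show [measurable]: "f \<in> borel_measurable ?M"
    using assms by (simp add: L2_per_def measurable_restrict_space1)
  have sq: "integrable ?M (\<lambda>x. (f x)\<^sup>2)" using assms by (simp add: L2_per_def)
  show "integrable ?M f"
    using Cauchy_Schwarz_integral(1)[of f ?M "\<lambda>x. 1"] sq by simp
  show "L1_norm f \<le> L2_norm f"
    using Cauchy_Schwarz_integral(2)[of f ?M "\<lambda>x. 1"] sq by (simp add: L1_norm_def L2_norm_def)
qed

lemma L2_per_diff:
  assumes "f \<in> L2_per" "g \<in> L2_per"
  shows "(\<lambda>x. f x - g x) \<in> L2_per"
proof -
  let ?M = "lebesgue_on (unit_cell :: (real ^ 'a) set)"
  have "cell_periodic (\<lambda>x. f x - g x)"
    unfolding cell_periodic_def
  proof (intro allI impI)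
    fix k :: "real ^ 'a" assume k: "\<forall>i. k $ i \<in> \<int>"
    have "AE x in lebesgue. f (x + k) = f x" "AE x in lebesgue. g (x + k) = g x"
      using assms k by (auto simp: L2_per_def cell_periodic_def)
    then show "AE x in lebesgue. f (x + k) - g (x + k) = f x - g x"
      by eventually_elim simp
  qed
  moreover have "integrable ?M (\<lambda>x. (f x - g x)\<^sup>2)"
  proof -
    have "integrable ?M (\<lambda>x. f x * g x)"
      using assms L2_per_imp_integrable(1) by (intro Cauchy_Schwarz_integral(1)) (auto simp: L2_per_def)
    then have "integrable ?M (\<lambda>x. (f x)\<^sup>2 + (g x)\<^sup>2 - 2 * (f x * g x))"
      using assms by (auto simp: L2_per_def)
    then show ?thesis by (simp add: power2_diff mult.assoc)
  qed
  ultimately show ?thesis using assms by (auto simp: L2_per_def)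
qed

lemma integrable_weighted_matrix:
  fixes A :: "real ^ 'n \<Rightarrow> real ^ 'n ^ 'n"
  assumes f: "f \<in> L2_per" and A: "A \<in> borel_measurable lebesgue"
    and K: "AE x in lebesgue_on unit_cell. norm (A x) \<le> K"
  shows "integrable (lebesgue_on unit_cell) (\<lambda>x. f x *\<^sub>R A x)"
    and "norm (LINT x|lebesgue_on unit_cell. f x *\<^sub>R A x) \<le> K * L1_norm f"
proof -
  let ?M = "lebesgue_on (unit_cell :: (real ^ 'n) set)"
  have [measurable]: "A \<in> borel_measurable ?M" "f \<in> borel_measurable ?M"
    using A L2_per_imp_integrable(1)[OF f] by (simp_all add: measurable_restrict_space1)
  have fint: "integrable ?M f" using L2_per_imp_integrable(2)[OF f] .
  have le: "AE x in ?M. norm (f x *\<^sub>R A x) \<le> K * \<bar>f x\<bar>"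
    using K
  proof eventually_elim
    case (elim x)
    then have "\<bar>f x\<bar> * norm (A x) \<le> \<bar>f x\<bar> * K" by (intro mult_left_mono) auto
    then show ?case by (simp add: mult.commute)
  qed
  show int: "integrable ?M (\<lambda>x. f x *\<^sub>R A x)"
  proof (rule Bochner_Integration.integrable_bound)
    show "integrable ?M (\<lambda>x. K * \<bar>f x\<bar>)" using fint by simp
    show "AE x in ?M. norm (f x *\<^sub>R A x) \<le> norm (K * \<bar>f x\<bar>)"
      using le by eventually_elim simp
  qed measurable
  have "norm (LINT x|?M. f x *\<^sub>R A x) \<le> (LINT x|?M. norm (f x *\<^sub>R A x))"
    by (rule integral_norm_bound)
  also have "\<dots> \<le> (LINT x|?M. K * \<bar>f x\<bar>)"
    using le fint by (intro integral_mono_AE integrable_norm[OF int]) auto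
  finally show "norm (LINT x|?M. f x *\<^sub>R A x) \<le> K * L1_norm f"
    by (simp add: L1_norm_def)
qed

lemma transpose_weighted_mean:
  assumes "integrable (lebesgue_on unit_cell) (\<lambda>x. f x *\<^sub>R A x)"
    and "AE x in lebesgue_on unit_cell. transpose (A x) = A x"
  shows "transpose (weighted_mean f A) = weighted_mean f A"
proof -
  let ?M = "lebesgue_on (unit_cell :: (real ^ 'a) set)"
  have "transpose (weighted_mean f A) = (LINT x|?M. transpose (f x *\<^sub>R A x))"
    unfolding weighted_mean_def by (rule integral_bounded_linear[OF bounded_linear_transpose assms(1), symmetric])
  also have "\<dots> = (LINT x|?M. f x *\<^sub>R A x)"
  proof (rule integral_cong_AE)
    show "(\<lambda>x. transpose (f x *\<^sub>R A x)) \<in> borel_measurable ?M"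
      using integrable_bounded_linear[OF bounded_linear_transpose assms(1)] by simp
    show "AE x in ?M. transpose (f x *\<^sub>R A x) = f x *\<^sub>R A x"
      using assms(2) by eventually_elim (simp add: linear_cmul[OF bounded_linear.linear[OF bounded_linear_transpose]])
  qed (use assms(1) in simp)
  finally show ?thesis by (simp add: weighted_mean_def)
qed

text \<open>The normalisation \<open>\<integral> r = 1\<close> is the only source of a definite sign: it excludes
  \<open>\<integral> \<rho> \<le> 0\<close>, and from \<open>\<integral> \<rho> > 0\<close> the quadratic form of the mean inherits the lower
  bound of \<open>B\<close>.\<close>

lemma weighted_mean_invariant_measure_coercive:
  fixes A :: "real ^ 'n \<Rightarrow> real ^ 'n ^ 'n"
  assumes lam: "0 < lam" and Lam: "0 < Lam" and A: "A \<in> elliptic_class lam Lam"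
    and \<delta>: "0 < \<delta>" "\<delta> \<le> 1" and cordes: "cordes \<delta> A" and r: "invariant_measure A r"
  obtains \<mu> where "0 < \<mu>" "\<And>\<xi>. \<mu> * (norm \<xi>)\<^sup>2 \<le> (weighted_mean r A *v \<xi>) \<bullet> \<xi>"
proof -
  let ?M = "lebesgue_on (unit_cell :: (real ^ 'n) set)"
  define K where "K = sqrt (real CARD('n)) * Lam"
  define q where "q = sqrt (1 - \<delta>)"
  have q: "0 \<le> q" "q < 1" using \<delta> by (auto simp: q_def)
  define \<gamma> where "\<gamma> x = trace (A x) / (norm (A x))\<^sup>2" for x
  define B where "B x = \<gamma> x *\<^sub>R A x" for x
  define \<rho> where "\<rho> x = r x / \<gamma> x" for x
  have K0: "0 < K" using Lam by (simp add: K_def)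
  have rL2: "r \<in> L2_per" and r1: "(LINT x|?M. r x) = 1"
    using r by (auto simp: invariant_measure_def)
  have Am [measurable]: "A \<in> borel_measurable lebesgue" using A by (simp add: elliptic_class_def)
  have rm [measurable]: "r \<in> borel_measurable lebesgue" using rL2 by (simp add: L2_per_def)
  have tr_m [measurable]: "(\<lambda>x. trace (A x)) \<in> borel_measurable lebesgue"
    unfolding inner_mat_1[symmetric] by measurable
  have \<gamma>m [measurable]: "\<gamma> \<in> borel_measurable lebesgue" unfolding \<gamma>_def by measurable
  have Bm [measurable]: "B \<in> borel_measurable lebesgue" unfolding B_def by measurable
  have \<rho>m [measurable]: "\<rho> \<in> borel_measurable lebesgue" unfolding \<rho>_def by measurable
  have onM: "f \<in> borel_measurable lebesgue \<Longrightarrow> f \<in> borel_measurable ?M" for f :: "real ^ 'n \<Rightarrow> 'b :: topological_space"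
    by (rule measurable_restrict_space1)
  have "AE x in lebesgue. norm (A x) \<le> K \<and> lam / K\<^sup>2 \<le> \<gamma> x \<and> \<gamma> x \<le> real CARD('n) / lam \<and> norm (B x - mat 1) \<le> q"
    using elliptic_class_AE[OF A] cordes[unfolded cordes_def]
  proof eventually_elim
    case (elim x)
    have ell: "lam * (norm \<xi>)\<^sup>2 \<le> (A x *v \<xi>) \<bullet> \<xi>" "(A x *v \<xi>) \<bullet> \<xi> \<le> Lam * (norm \<xi>)\<^sup>2" for \<xi>
      using elim(1) by auto
    have nonneg: "0 \<le> (A x *v \<xi>) \<bullet> \<xi>" for \<xi>
      using ell(1)[of \<xi>] lam by (meson order_trans zero_le_mult_iff zero_le_power2 less_imp_le)
    have n: "norm (A x) \<le> K"
      unfolding K_def by (rule norm_le_sqrt_card_mult) (use elim nonneg ell Lam in auto)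
    show ?case
      using n elliptic_normalisation_bounds[OF lam n ell(1)]
        cordes_normalisation[of "A x" \<delta>] \<delta>(1) elim(2)
      by (simp add: \<gamma>_def B_def q_def)
  qed
  then have ae: "AE x in ?M. norm (A x) \<le> K \<and> lam / K\<^sup>2 \<le> \<gamma> x \<and> \<gamma> x \<le> real CARD('n) / lam \<and> norm (B x - mat 1) \<le> q"
    unfolding AE_unit_cell_iff by eventually_elim simp
  have m0: "0 < lam / K\<^sup>2" using lam K0 by simp
  have \<gamma>_ne: "AE x in ?M. \<gamma> x \<noteq> 0"
    using ae by eventually_elim (use m0 in auto)
  have qB: "AE x in ?M. norm (B x - mat 1) \<le> q" using ae by eventually_elim simp
  have g1: "AE x in ?M. lam / K\<^sup>2 \<le> \<gamma> x \<and> \<gamma> x \<le> real CARD('n) / lam" using ae by eventually_elim simp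
  have \<rho>_sq: "integrable ?M (\<lambda>x. (\<rho> x)\<^sup>2)"
  proof -
    have "integrable ?M (\<lambda>x. (r x)\<^sup>2 * (1 / (\<gamma> x)\<^sup>2))"
    proof (rule integrable_mult_bounded)
      show "integrable ?M (\<lambda>x. (r x)\<^sup>2)" using rL2 by (simp add: L2_per_def)
      show "(\<lambda>x. 1 / (\<gamma> x)\<^sup>2) \<in> borel_measurable ?M" by (rule onM) measurable
      show "AE x in ?M. \<bar>1 / (\<gamma> x)\<^sup>2\<bar> \<le> 1 / (lam / K\<^sup>2)\<^sup>2"
        using g1
      proof eventually_elim
        case (elim x)
        then have "(lam / K\<^sup>2)\<^sup>2 \<le> (\<gamma> x)\<^sup>2" using m0 by (intro power_mono) auto
        then have "1 / (\<gamma> x)\<^sup>2 \<le> 1 / (lam / K\<^sup>2)\<^sup>2"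
          using m0 by (intro frac_le) auto
        then show ?case by simp
      qed
    qed
    then show ?thesis by (simp add: \<rho>_def power_divide)
  qed
  have orth: "(LINT x|?M. \<rho> x * (B x \<bullet> potential_hessian N f x)) = 0" for N f
  proof -
    have "(LINT x|?M. r x * (- (A x \<bullet> potential_hessian N f x))) = 0"
      using r potential_in_H_per has_weak_hessian_potential unfolding invariant_measure_def by blast
    then have "(LINT x|?M. r x * (A x \<bullet> potential_hessian N f x)) = 0" by simp
    moreover have "potential_hessian N f \<in> borel_measurable lebesgue"
      by (rule measurable_completion)
        (simp add: borel_measurable_continuous_onI continuous_on_potential_hessian)
    then have "(LINT x|?M. \<rho> x * (B x \<bullet> potential_hessian N f x)) = (LINT x|?M. r x * (A x \<bullet> potential_hessian N f x))"
      by (intro integral_cong_AE onM; measurable?)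
         (use \<gamma>_ne in eventually_elim, simp add: \<rho>_def B_def)
    ultimately show ?thesis by simp
  qed
  note bounds = weighted_integral_bounds[OF Bm _ \<rho>m qB q _ \<rho>_sq orth]
  define S where "S = (LINT x|?M. \<rho> x)"
  have S: "0 < S"
  proof (rule ccontr)
    assume "\<not> 0 < S"
    then have "S \<le> 0" by simp
    have "(LINT x|?M. \<rho> x * \<gamma> x) = (LINT x|?M. r x)"
      by (intro integral_cong_AE onM; measurable?)
         (use \<gamma>_ne in eventually_elim, simp add: \<rho>_def)
    then have "1 \<le> lam / K\<^sup>2 * S"
      using bounds(2)[OF \<gamma>m g1] \<open>S \<le> 0\<close> r1 by (simp add: S_def)
    moreover have "lam / K\<^sup>2 * S \<le> 0" using \<open>S \<le> 0\<close> m0 by (intro mult_nonneg_nonpos) auto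
    ultimately show False by simp
  qed
  have coercive: "(1 - q) * S * (norm \<xi>)\<^sup>2 \<le> (weighted_mean r A *v \<xi>) \<bullet> \<xi>" for \<xi>
  proof -
    have qm: "(\<lambda>x. (F x *v \<xi>) \<bullet> \<xi>) \<in> borel_measurable lebesgue" if "F \<in> borel_measurable lebesgue" for F :: "real ^ 'n \<Rightarrow> real ^ 'n ^ 'n"
      using measurable_compose[OF that borel_measurable_continuous_onI[OF linear_continuous_on[OF bounded_linear_quadratic_form]]] .
    have "AE x in ?M. (1 - q) * (norm \<xi>)\<^sup>2 \<le> (B x *v \<xi>) \<bullet> \<xi> \<and> (B x *v \<xi>) \<bullet> \<xi> \<le> (1 + q) * (norm \<xi>)\<^sup>2"
      using qB
    proof eventually_elim
      case (elim x)
      have "(B x *v \<xi>) \<bullet> \<xi> = (norm \<xi>)\<^sup>2 + ((B x - mat 1) *v \<xi>) \<bullet> \<xi>"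
        by (simp add: matrix_vector_mult_diff_rdistrib inner_diff_left power2_norm_eq_inner)
      moreover have "\<bar>((B x - mat 1) *v \<xi>) \<bullet> \<xi>\<bar> \<le> q * (norm \<xi>)\<^sup>2"
        using abs_quadratic_form_le[of "B x - mat 1" \<xi>] elim
        by (meson order_trans mult_right_mono zero_le_power2)
      ultimately show ?case by (simp add: algebra_simps abs_le_iff)
    qed
    from bounds(1)[OF qm[OF Bm] this]
    have "(1 - q) * (norm \<xi>)\<^sup>2 * S \<le> (LINT x|?M. \<rho> x * ((B x *v \<xi>) \<bullet> \<xi>))"
      using S by (simp add: S_def)
    also have "\<dots> = (LINT x|?M. ((r x *\<^sub>R A x) *v \<xi>) \<bullet> \<xi>)"
    proof (rule integral_cong_AE)
      show "(\<lambda>x. \<rho> x * ((B x *v \<xi>) \<bullet> \<xi>)) \<in> borel_measurable ?M"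
        using qm[OF Bm] by (intro onM borel_measurable_times \<rho>m)
      show "(\<lambda>x. ((r x *\<^sub>R A x) *v \<xi>) \<bullet> \<xi>) \<in> borel_measurable ?M"
        by (intro onM qm) measurable
      show "AE x in ?M. \<rho> x * ((B x *v \<xi>) \<bullet> \<xi>) = ((r x *\<^sub>R A x) *v \<xi>) \<bullet> \<xi>"
        using \<gamma>_ne by eventually_elim (simp add: \<rho>_def B_def scaleR_matrix_vector_assoc[symmetric])
    qed
    also have "\<dots> = (weighted_mean r A *v \<xi>) \<bullet> \<xi>"
      unfolding weighted_mean_def
      by (rule integral_bounded_linear[OF bounded_linear_quadratic_form integrable_weighted_matrix(1)[OF rL2 Am, of K]])
         (use ae in eventually_elim, simp)
    finally show ?thesis by (simp add: mult_ac)
  qed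
  show ?thesis
    by (rule that[OF _ coercive]) (use S q in simp)
qed

theorem lemma4p3:
  fixes A :: "real ^ 'n \<Rightarrow> real ^ 'n ^ 'n"
    and lam Lam \<delta> :: real
    and r :: "real ^ 'n \<Rightarrow> real"
    and rh :: "real \<Rightarrow> real ^ 'n \<Rightarrow> real"
  assumes "0 < lam" and "0 < Lam"
    and "A \<in> elliptic_class lam Lam"
    and "0 < \<delta>" and "\<delta> \<le> 1"
    and "cordes \<delta> A"
    and "invariant_measure A r"
    and "\<And>h. 0 < h \<Longrightarrow> rh h \<in> L2_per"
    and "((\<lambda>h. L2_norm (\<lambda>x. r x - rh h x)) \<longlongrightarrow> 0) (at_right 0)"
  shows "transpose (weighted_mean r A) = weighted_mean r A
    \<and> (\<forall>h>0. transpose (weighted_mean (rh h) A) = weighted_mean (rh h) A)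
    \<and> (\<forall>h>0. norm (weighted_mean r A - weighted_mean (rh h) A)
                \<le> sqrt (real CARD('n)) * Lam * L1_norm (\<lambda>x. r x - rh h x)
            \<and> sqrt (real CARD('n)) * Lam * L1_norm (\<lambda>x. r x - rh h x)
                \<le> sqrt (real CARD('n)) * Lam * L2_norm (\<lambda>x. r x - rh h x))
    \<and> (\<forall>\<^sub>F h in at_right 0. positive_definite (weighted_mean (rh h) A))"
proof -
  define K where "K = sqrt (real CARD('n)) * Lam"
  have K0: "0 < K" using assms(2) by (simp add: K_def)
  have rL2: "r \<in> L2_per" using assms(7) by (simp add: invariant_measure_def)
  have Am: "A \<in> borel_measurable lebesgue" using assms(3) by (simp add: elliptic_class_def)
  have "AE x in lebesgue. transpose (A x) = A x \<and> norm (A x) \<le> K"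
    using elliptic_class_AE[OF assms(3)]
  proof eventually_elim
    case (elim x)
    have "0 \<le> (A x *v \<xi>) \<bullet> \<xi>" for \<xi>
      using elim assms(1) by (meson order_trans zero_le_mult_iff zero_le_power2 less_imp_le)
    then have "norm (A x) \<le> K"
      unfolding K_def by (rule norm_le_sqrt_card_mult[rotated]) (use elim assms(2) in auto)
    then show ?case using elim by simp
  qed
  then have sym: "AE x in lebesgue_on unit_cell. transpose (A x) = A x"
    and K: "AE x in lebesgue_on unit_cell. norm (A x) \<le> K"
    unfolding AE_unit_cell_iff by (eventually_elim, simp)+
  have int: "integrable (lebesgue_on unit_cell) (\<lambda>x. f x *\<^sub>R A x)" if "f \<in> L2_per" for f
    by (rule integrable_weighted_matrix(1)[OF that Am K])
  have 1: "norm (weighted_mean r A - weighted_mean (rh h) A) \<le> K * L1_norm (\<lambda>x. r x - rh h x)" if "0 < h" for h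
  proof -
    have "weighted_mean r A - weighted_mean (rh h) A = (LINT x|lebesgue_on unit_cell. (r x - rh h x) *\<^sub>R A x)"
      unfolding weighted_mean_def scaleR_diff_left
      by (rule Bochner_Integration.integral_diff[OF int[OF rL2] int[OF assms(8)[OF that]], symmetric])
    then show ?thesis
      using integrable_weighted_matrix(2)[OF L2_per_diff[OF rL2 assms(8)[OF that]] Am K] by simp
  qed
  have 2: "K * L1_norm (\<lambda>x. r x - rh h x) \<le> K * L2_norm (\<lambda>x. r x - rh h x)" if "0 < h" for h
    using L2_per_imp_integrable(3)[OF L2_per_diff[OF rL2 assms(8)[OF that]]] K0 by simp
  have 3: "transpose (weighted_mean (rh h) A) = weighted_mean (rh h) A" if "0 < h" for h
    by (rule transpose_weighted_mean[OF int[OF assms(8)[OF that]] sym])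
  obtain \<mu> where \<mu>: "0 < \<mu>" "\<And>\<xi>. \<mu> * (norm \<xi>)\<^sup>2 \<le> (weighted_mean r A *v \<xi>) \<bullet> \<xi>"
    using weighted_mean_invariant_measure_coercive[OF assms(1-7)] by metis
  have "((\<lambda>h. K * L2_norm (\<lambda>x. r x - rh h x)) \<longlongrightarrow> K * 0) (at_right 0)"
    by (intro tendsto_intros assms(9))
  then have "\<forall>\<^sub>F h in at_right 0. K * L2_norm (\<lambda>x. r x - rh h x) < \<mu>"
    using \<mu>(1) by (auto dest: order_tendstoD(2))
  then have "\<forall>\<^sub>F h in at_right 0. positive_definite (weighted_mean (rh h) A)"
    using eventually_at_right_less
  proof eventually_elim
    case (elim h)
    let ?D = "weighted_mean r A - weighted_mean (rh h) A"
    have D: "norm ?D < \<mu>" using 1[OF elim(2)] 2[OF elim(2)] elim(1) by simp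
    have "0 < (weighted_mean (rh h) A *v \<xi>) \<bullet> \<xi>" if "\<xi> \<noteq> 0" for \<xi>
    proof -
      have "(weighted_mean (rh h) A *v \<xi>) \<bullet> \<xi> = (weighted_mean r A *v \<xi>) \<bullet> \<xi> - (?D *v \<xi>) \<bullet> \<xi>"
        by (simp add: matrix_vector_mult_diff_rdistrib inner_diff_left)
      moreover have "(?D *v \<xi>) \<bullet> \<xi> \<le> norm ?D * (norm \<xi>)\<^sup>2"
        using abs_quadratic_form_le[of ?D \<xi>] by simp
      moreover have "norm ?D * (norm \<xi>)\<^sup>2 < \<mu> * (norm \<xi>)\<^sup>2"
        using D that by (intro mult_strict_right_mono) auto
      ultimately show ?thesis using \<mu>(2)[of \<xi>] by simp
    qed
    then show ?case using 3[OF elim(2)] by (simp add: positive_definite_def)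
  qed
  then show ?thesis
    using 1 2 3 transpose_weighted_mean[OF int[OF rL2] sym] unfolding K_def by blast
qed

end
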